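(* Let $k\geq 1$ be an integer and let $S^k$ be the $k$-dimensional sphere. Then $N\mathcal{E}(S^k)=k$.
   Context: All spaces are based and have the based homotopy type of a CW-complex; all maps and homotopies preserve base points. For a connected space $X$, $[X,X]$ is the monoid (under composition) of based homotopy classes of based self-maps of $X$, and $\mathcal{E}(X)\subseteq[X,X]$ is the group of classes of self-homotopy equivalences. For a nonnegative integer $j$, $\mathcal{A}_\sharp^j(X)\subseteq[X,X]$ is the set of classes $f$ such that the induced map $\pi_i(f):\pi_i(X)\to\pi_i(X)$ is an isomorphism for all $i=0,1,\dots,j$. One always has $\mathcal{E}(X)\subseteq\mathcal{A}_\sharp^j(X)$. The self-closeness number of $X$ is $N\mathcal{E}(X)=\min\{j\geq 0 : \mathcal{A}_\sharp^j(X)=\mathcal{E}(X)\}$, with $N\mathcal{E}(X)=\infty$ if no such nonnegative integer $j$ exists. *)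

theory Defs
  imports "HOL-Analysis.Abstract_Euclidean_Space" "HOL-Algebra.Group" "HOL-Library.Extended_Nat"
begin

section \<open>Based self-maps up to based homotopy\<close>

definition based_self_map :: "'a topology \<Rightarrow> 'a \<Rightarrow> ('a \<Rightarrow> 'a) \<Rightarrow> bool" where
  "based_self_map X p f \<longleftrightarrow> continuous_map X X f \<and> f p = p"

definition based_homotopic :: "'a topology \<Rightarrow> 'a \<Rightarrow> ('a \<Rightarrow> 'a) \<Rightarrow> ('a \<Rightarrow> 'a) \<Rightarrow> bool" where
  "based_homotopic X p f g \<longleftrightarrow> homotopic_with (\<lambda>h. h p = p) X X f g"

text \<open>Functions that agree on \<^term>\<open>topspace X\<close> are homotopic, so their (irrelevant) values
  outside the space do not affect the class.\<close>

definition self_map_class :: "'a topology \<Rightarrow> 'a \<Rightarrow> ('a \<Rightarrow> 'a) \<Rightarrow> ('a \<Rightarrow> 'a) set" where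
  "self_map_class X p f = {g. based_homotopic X p f g}"

definition based_self_equivalence :: "'a topology \<Rightarrow> 'a \<Rightarrow> ('a \<Rightarrow> 'a) \<Rightarrow> bool" where
  "based_self_equivalence X p f \<longleftrightarrow>
     based_self_map X p f \<and>
     (\<exists>g. based_self_map X p g \<and>
          based_homotopic X p (g \<circ> f) id \<and> based_homotopic X p (f \<circ> g) id)"

definition self_equivalence_classes :: "'a topology \<Rightarrow> 'a \<Rightarrow> ('a \<Rightarrow> 'a) set set" where
  "self_equivalence_classes X p = {self_map_class X p f |f. based_self_equivalence X p f}"


section \<open>Homotopy groups\<close>

text \<open>Elements of the \<open>n\<close>-th homotopy set are homotopy classes, relative to the boundary, of maps
  of the cube \<open>[0,1]\<^sup>n\<close> sending the boundary to the base point. The cube of dimension 0 is a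
  single point with empty boundary, so for \<open>n = 0\<close> these are the path components of \<open>X\<close>.\<close>

definition unit_cube :: "nat \<Rightarrow> (nat \<Rightarrow> real) topology" where
  "unit_cube n = product_topology (\<lambda>_. top_of_set {0..1}) {..<n}"

definition cube_boundary :: "nat \<Rightarrow> (nat \<Rightarrow> real) set" where
  "cube_boundary n = {t \<in> topspace (unit_cube n). \<exists>i<n. t i = 0 \<or> t i = 1}"

definition cube_map :: "nat \<Rightarrow> 'a topology \<Rightarrow> 'a \<Rightarrow> ((nat \<Rightarrow> real) \<Rightarrow> 'a) \<Rightarrow> bool" where
  "cube_map n X p a \<longleftrightarrow> continuous_map (unit_cube n) X a \<and> (\<forall>t\<in>cube_boundary n. a t = p)"

definition cube_homotopic ::
    "nat \<Rightarrow> 'a topology \<Rightarrow> 'a \<Rightarrow> ((nat \<Rightarrow> real) \<Rightarrow> 'a) \<Rightarrow> ((nat \<Rightarrow> real) \<Rightarrow> 'a) \<Rightarrow> bool" where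
  "cube_homotopic n X p a b \<longleftrightarrow>
     homotopic_with (\<lambda>h. \<forall>t\<in>cube_boundary n. h t = p) (unit_cube n) X a b"

definition cube_class ::
    "nat \<Rightarrow> 'a topology \<Rightarrow> 'a \<Rightarrow> ((nat \<Rightarrow> real) \<Rightarrow> 'a) \<Rightarrow> ((nat \<Rightarrow> real) \<Rightarrow> 'a) set" where
  "cube_class n X p a = {b. cube_homotopic n X p a b}"

definition cube_concat ::
    "((nat \<Rightarrow> real) \<Rightarrow> 'a) \<Rightarrow> ((nat \<Rightarrow> real) \<Rightarrow> 'a) \<Rightarrow> (nat \<Rightarrow> real) \<Rightarrow> 'a" where
  "cube_concat a b t =
     (if t 0 \<le> 1 / 2 then a (t(0 := 2 * t 0)) else b (t(0 := 2 * t 0 - 1)))"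

text \<open>The product of two classes is the class of the concatenation of representatives, written
  without choosing any. It is meaningful only for \<open>n \<ge> 1\<close>; for \<open>n = 0\<close> only the carrier
  is used.\<close>

definition homotopy_group ::
    "nat \<Rightarrow> 'a topology \<Rightarrow> 'a \<Rightarrow> ((nat \<Rightarrow> real) \<Rightarrow> 'a) set monoid" where
  "homotopy_group n X p =
     \<lparr>carrier = {cube_class n X p a |a. cube_map n X p a},
      monoid.mult = (\<lambda>A B. {c. \<exists>a\<in>A. \<exists>b\<in>B. cube_homotopic n X p (cube_concat a b) c}),
      one = cube_class n X p (\<lambda>_. p)\<rparr>"

definition homotopy_group_map ::
    "nat \<Rightarrow> 'a topology \<Rightarrow> 'a \<Rightarrow> ('a \<Rightarrow> 'a) \<Rightarrow>
     ((nat \<Rightarrow> real) \<Rightarrow> 'a) set \<Rightarrow> ((nat \<Rightarrow> real) \<Rightarrow> 'a) set" where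
  "homotopy_group_map n X p f A = {b. \<exists>a\<in>A. cube_homotopic n X p (f \<circ> a) b}"

definition induces_homotopy_iso :: "nat \<Rightarrow> 'a topology \<Rightarrow> 'a \<Rightarrow> ('a \<Rightarrow> 'a) \<Rightarrow> bool" where
  "induces_homotopy_iso n X p f \<longleftrightarrow>
     (if n = 0
      then bij_betw (homotopy_group_map 0 X p f)
             (carrier (homotopy_group 0 X p)) (carrier (homotopy_group 0 X p))
      else homotopy_group_map n X p f \<in> iso (homotopy_group n X p) (homotopy_group n X p))"

lemma cube_homotopic_compose_left:
  assumes "based_self_map X p f" and "cube_homotopic n X p a b"
  shows "cube_homotopic n X p (f \<circ> a) (f \<circ> b)"
  using assms(2) unfolding cube_homotopic_def
  by (rule homotopic_with_compose_continuous_map_left)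
    (use assms(1) in \<open>simp_all add: based_self_map_def\<close>)

lemma cube_homotopic_compose_right:
  assumes "based_homotopic X p f g" and "cube_map n X p a"
  shows "cube_homotopic n X p (f \<circ> a) (g \<circ> a)"
  using assms(1) unfolding cube_homotopic_def based_homotopic_def
  by (rule homotopic_with_compose_continuous_map_right)
    (use assms(2) in \<open>simp_all add: cube_map_def\<close>)

lemma homotopy_group_map_class:
  assumes f: "based_self_map X p f" and a: "cube_map n X p a"
  shows "homotopy_group_map n X p f (cube_class n X p a) = cube_class n X p (f \<circ> a)"
proof -
  have "cube_homotopic n X p a a"
    using a by (simp add: cube_homotopic_def cube_map_def)
  moreover have "cube_homotopic n X p (f \<circ> a) c"
    if "cube_homotopic n X p a b" "cube_homotopic n X p (f \<circ> b) c" for b c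
    using cube_homotopic_compose_left[OF f that(1)] that(2)
    unfolding cube_homotopic_def by (rule homotopic_with_trans)
  ultimately show ?thesis
    unfolding homotopy_group_map_def cube_class_def by blast
qed

lemma homotopy_group_map_homotopic:
  assumes fg: "based_homotopic X p f g" and A: "A \<in> carrier (homotopy_group n X p)"
  shows "homotopy_group_map n X p f A = homotopy_group_map n X p g A"
proof -
  have f: "based_self_map X p f" and g: "based_self_map X p g"
    using homotopic_with_imp_continuous_maps[OF fg[unfolded based_homotopic_def]]
      homotopic_with_imp_property[OF fg[unfolded based_homotopic_def]]
    by (simp_all add: based_self_map_def)
  obtain a where a: "cube_map n X p a" "A = cube_class n X p a"
    using A by (auto simp: homotopy_group_def)
  have "cube_homotopic n X p (f \<circ> a) (g \<circ> a)"
    by (rule cube_homotopic_compose_right[OF fg a(1)])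
  then have "cube_class n X p (f \<circ> a) = cube_class n X p (g \<circ> a)"
    unfolding cube_class_def cube_homotopic_def
    by (intro Collect_cong iffI) (erule (1) homotopic_with_trans[OF homotopic_with_symD] homotopic_with_trans)+
  then show ?thesis
    using a f g by (simp add: homotopy_group_map_class)
qed


section \<open>The self-closeness number\<close>

text \<open>By \<open>homotopy_group_map_homotopic\<close>, the choice of representative is immaterial.\<close>

definition sharp_classes :: "nat \<Rightarrow> 'a topology \<Rightarrow> 'a \<Rightarrow> ('a \<Rightarrow> 'a) set set" where
  "sharp_classes j X p =
     {self_map_class X p f |f. based_self_map X p f \<and> (\<forall>i\<le>j. induces_homotopy_iso i X p f)}"

text \<open>The infimum of the empty set in \<^typ>\<open>enat\<close> is \<open>\<infinity>\<close>.\<close>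

definition self_closeness_number :: "'a topology \<Rightarrow> 'a \<Rightarrow> enat" where
  "self_closeness_number X p = Inf (enat ` {j. sharp_classes j X p = self_equivalence_classes X p})"

end

theory Submission
  imports Defs "HOL-Homology.Brouwer_Degree" "HOL-Analysis.Weierstrass_Theorems"
begin

text \<open>The lower bound comes from the constant map. For \<open>i < k\<close> every element of
  \<open>\<pi>\<^sub>i(S\<^sup>k)\<close> is trivial, so the constant map induces isomorphisms in all
  degrees below \<open>k\<close>. It is not a homotopy equivalence, since \<open>S\<^sup>k\<close> is not contractible
  (\<open>const_induces_homotopy_iso_low_dimension\<close>, \<open>const_class_not_equivalence\<close>).

  For the upper bound, an equivalence induces isomorphisms by functoriality. Conversely, the sphere is
  the cube with its boundary collapsed to a point; let \<open>q\<close> be the collapse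
  (\<open>nsphere_collapse_map\<close>). Then \<open>g \<mapsto> [g \<circ> q]\<close> identifies based classes
  of self-maps of \<open>S\<^sup>k\<close> with \<open>\<pi>\<^sub>k(S\<^sup>k)\<close>, and \<open>f\<^sub>*\<close> becomes \<open>[g] \<mapsto> [f \<circ> g]\<close>. If \<open>f\<^sub>*\<close> is bijective,
  surjectivity gives \<open>g\<close> with \<open>f \<circ> g \<simeq> id\<close>. Hence \<open>f \<circ> (g \<circ> f) \<simeq> f \<circ> id\<close>, and injectivity gives
  \<open>g \<circ> f \<simeq> id\<close> (\<open>homotopy_iso_imp_based_self_equivalence\<close>).

  The vanishing of \<open>\<pi>\<^sub>i(S\<^sup>k)\<close> for \<open>i < k\<close> is elementary. A map from the \<open>i\<close>-cube to the
  sphere is deformed, rel boundary, to a Lipschitz map by the Stone-Weierstrass theorem. A Lipschitz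
  map from a cube of smaller dimension misses some point \<open>x\<close> of the sphere, because it cannot
  hit enough well-separated points. The complement of \<open>x\<close> in the sphere contracts to the base point
  (\<open>cube_homotopic_to_lipschitz\<close>, \<open>lipschitz_sphere_map_misses\<close>, \<open>cube_homotopic_const_if_misses\<close>).

  Reflections in hyperplanes provide the explicit maps between points of the sphere. The reflection in
  the hyperplane orthogonal to \<open>y - x\<close> exchanges the unit vectors \<open>x\<close> and \<open>y\<close>; so the map
  \<open>w \<mapsto> reflect w x\<close> is an inverse stereographic projection from \<open>x\<close>, applied to directions of lines through \<open>x\<close>.\<close>

section \<open>Cubes and homotopies rel boundary\<close>

lemma topspace_unit_cube: "topspace (unit_cube n) = PiE {..<n} (\<lambda>_. {0..1})"
  by (simp add: unit_cube_def)

text \<open>The cube, a product of abstract intervals, is a subspace of the type \<^typ>\<open>nat \<Rightarrow> real\<close>: its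
  points are \<open>undefined\<close> at all further coordinates, so those are constant. This makes the
  continuity rules for that type available.\<close>

lemma unit_cube_eq_top_of_set: "unit_cube n = top_of_set (PiE {..<n} (\<lambda>_. {0..1}))"
proof -
  let ?C = "PiE {..<n} (\<lambda>_. {0..1::real})"
  have 1: "continuous_map (unit_cube n) (top_of_set ?C) id"
  proof -
    have "continuous_map (unit_cube n) (product_topology (\<lambda>_. euclideanreal) UNIV) id"
    proof (subst continuous_map_componentwise_UNIV, rule allI)
      fix i
      show "continuous_map (unit_cube n) euclideanreal (\<lambda>x. id x i)"
      proof (cases "i < n")
        case True
        then show ?thesis
          using continuous_map_product_projection[of i "{..<n}" "\<lambda>_. top_of_set {0..1::real}"]
          by (simp add: unit_cube_def continuous_map_into_fulltopology)
      next
        case False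
        have "continuous_map (unit_cube n) euclideanreal (\<lambda>x. undefined)"
          by simp
        then show ?thesis
          by (rule continuous_map_eq) (use False in \<open>auto simp: topspace_unit_cube PiE_def extensional_def\<close>)
      qed
    qed
    then show ?thesis
      unfolding euclidean_product_topology
      unfolding continuous_map_in_subtopology by (simp add: topspace_unit_cube)
  qed
  have 2: "continuous_map (top_of_set ?C) (unit_cube n) id"
  proof -
    have "continuous_on ?C (\<lambda>x. x i)" for i
      by (rule continuous_on_product_then_coordinatewise[OF continuous_on_id])
    then have "continuous_map (top_of_set ?C) (top_of_set {0..1}) (\<lambda>x. x i)" if "i < n" for i
      using that by (auto simp: continuous_map_in_subtopology)
    then show ?thesis
      unfolding unit_cube_def by (simp add: continuous_map_componentwise PiE_def)
  qed
  have "homeomorphic_maps (unit_cube n) (top_of_set ?C) id id"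
    unfolding homeomorphic_maps_def by (intro conjI ballI 1 2) (simp_all only: id_apply)
  then show ?thesis
    unfolding homeomorphic_maps_id by (rule sym)
qed

lemma compact_space_unit_cube: "compact_space (unit_cube n)"
  unfolding unit_cube_def by (simp add: compact_space_product_topology compact_space_subtopology)

lemma cube_boundary_subset: "cube_boundary n \<subseteq> topspace (unit_cube n)"
  by (auto simp: cube_boundary_def)

lemma cube_homotopic_sym: "cube_homotopic n X p a b \<Longrightarrow> cube_homotopic n X p b a"
  unfolding cube_homotopic_def by (rule homotopic_with_symD)

lemma cube_homotopic_trans:
  "cube_homotopic n X p a b \<Longrightarrow> cube_homotopic n X p b c \<Longrightarrow> cube_homotopic n X p a c"
  unfolding cube_homotopic_def by (rule homotopic_with_trans)

lemma cube_homotopic_refl [simp]: "cube_homotopic n X p a a \<longleftrightarrow> cube_map n X p a"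
  by (simp add: cube_homotopic_def cube_map_def)

lemma cube_homotopic_imp_cube_map:
  assumes "cube_homotopic n X p a b" shows "cube_map n X p a" "cube_map n X p b"
  using homotopic_with_imp_continuous_maps[OF assms[unfolded cube_homotopic_def]]
    homotopic_with_imp_property[OF assms[unfolded cube_homotopic_def]]
  by (simp_all add: cube_map_def)

lemma cube_class_eq_iff:
  assumes "cube_map n X p a"
  shows "cube_class n X p a = cube_class n X p b \<longleftrightarrow> cube_homotopic n X p a b"
proof
  assume eq: "cube_class n X p a = cube_class n X p b"
  have "a \<in> cube_class n X p a"
    using assms by (simp add: cube_class_def)
  then have "cube_homotopic n X p b a"
    unfolding eq by (simp add: cube_class_def)
  then show "cube_homotopic n X p a b"
    by (rule cube_homotopic_sym)
next
  assume ab: "cube_homotopic n X p a b"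
  have "cube_homotopic n X p a c \<longleftrightarrow> cube_homotopic n X p b c" for c
  proof
    show "cube_homotopic n X p b c" if "cube_homotopic n X p a c"
      by (rule cube_homotopic_trans[OF cube_homotopic_sym[OF ab] that])
    show "cube_homotopic n X p a c" if "cube_homotopic n X p b c"
      by (rule cube_homotopic_trans[OF ab that])
  qed
  then show "cube_class n X p a = cube_class n X p b"
    by (simp add: cube_class_def)
qed

lemma cube_homotopic_iff:
  "cube_homotopic n X p a b \<longleftrightarrow>
     (\<exists>h. continuous_map (prod_topology (top_of_set {0..1::real}) (unit_cube n)) X h \<and>
          (\<forall>t\<in>topspace (unit_cube n). h (0, t) = a t) \<and>
          (\<forall>t\<in>topspace (unit_cube n). h (1, t) = b t) \<and>
          (\<forall>s\<in>{0..1}. \<forall>t\<in>cube_boundary n. h (s, t) = p))"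
  unfolding cube_homotopic_def
proof (rule homotopic_with[where P = "\<lambda>h. \<forall>t\<in>cube_boundary n. h t = p"])
  fix h k :: "(nat \<Rightarrow> real) \<Rightarrow> 'a"
  assume "\<And>t. t \<in> topspace (unit_cube n) \<Longrightarrow> h t = k t"
  then have "\<And>t. t \<in> cube_boundary n \<Longrightarrow> h t = k t"
    using cube_boundary_subset by blast
  then show "(\<forall>t\<in>cube_boundary n. h t = p) \<longleftrightarrow> (\<forall>t\<in>cube_boundary n. k t = p)"
    by simp
qed

lemma based_homotopic_iff:
  assumes "p \<in> topspace X"
  shows "based_homotopic X p f g \<longleftrightarrow>
     (\<exists>h. continuous_map (prod_topology (top_of_set {0..1::real}) X) X h \<and>
          (\<forall>x\<in>topspace X. h (0, x) = f x) \<and> (\<forall>x\<in>topspace X. h (1, x) = g x) \<and>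
          (\<forall>s\<in>{0..1}. h (s, p) = p))"
  unfolding based_homotopic_def
proof (rule homotopic_with[where P = "\<lambda>h. h p = p"])
  fix h k :: "'a \<Rightarrow> 'a"
  assume "\<And>x. x \<in> topspace X \<Longrightarrow> h x = k x"
  from this[OF assms] show "h p = p \<longleftrightarrow> k p = p"
    by metis
qed

lemma cube_map_compose:
  "based_self_map X p f \<Longrightarrow> cube_map n X p a \<Longrightarrow> cube_map n X p (f \<circ> a)"
  unfolding based_self_map_def cube_map_def
  by (elim conjE, intro conjI continuous_map_compose[of "unit_cube n" X a X f]) simp_all

lemma based_self_map_compose:
  "based_self_map X p f \<Longrightarrow> based_self_map X p g \<Longrightarrow> based_self_map X p (g \<circ> f)"
  unfolding based_self_map_def
  by (elim conjE, intro conjI continuous_map_compose[of X X f X g]) simp_all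

lemma based_self_map_id: "based_self_map X p id"
  by (simp add: based_self_map_def)

section \<open>Induced maps on homotopy groups\<close>

lemma unit_cube_update:
  assumes "t \<in> topspace (unit_cube n)" "0 < n" "0 \<le> u" "u \<le> 1"
  shows "t(0 := u) \<in> topspace (unit_cube n)"
  using assms by (auto simp: topspace_unit_cube PiE_iff extensional_def)

lemma prod_unit_interval_cube:
  "prod_topology (top_of_set {0..1}) (unit_cube n) =
     top_of_set ({0..1::real} \<times> PiE {..<n} (\<lambda>_. {0..1}))"
  by (simp add: unit_cube_eq_top_of_set)

text \<open>Reparametrizing with a function \<open>r\<close> from the whole line to \<open>[0, 1]\<close> allows the two halves of a
  concatenation to be written as maps on the whole cube, which are then glued along \<open>t 0 = 1/2\<close>.\<close>

lemma continuous_map_reparametrize_first: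
  fixes r :: "real \<Rightarrow> real"
  assumes n: "0 < n" and r: "continuous_on UNIV r" "\<And>u. 0 \<le> r u \<and> r u \<le> 1"
  shows "continuous_map (prod_topology (top_of_set {0..1::real}) (unit_cube n))
    (prod_topology (top_of_set {0..1}) (unit_cube n)) (\<lambda>(s, t). (s, t(0 := r (t 0))))"
proof -
  let ?S = "{0..1::real} \<times> PiE {..<n} (\<lambda>_. {0..1::real})"
  have coord: "continuous_on ?S (\<lambda>x. snd x i)" for i
    by (rule continuous_on_product_then_coordinatewise[OF continuous_on_snd[OF continuous_on_id]])
  have "continuous_on ?S (\<lambda>x. ((snd x)(0 := r (snd x 0))) i)" for i
  proof (cases "i = 0")
    case True
    then show ?thesis
      using continuous_on_compose2[OF r(1) coord[of 0]] by simp
  next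
    case False
    then show ?thesis by (simp add: coord)
  qed
  then have "continuous_on ?S (\<lambda>x. (snd x)(0 := r (snd x 0)))"
    by (rule continuous_on_coordinatewise_then_product)
  then have "continuous_on ?S (\<lambda>x. (fst x, (snd x)(0 := r (snd x 0))))"
    by (rule continuous_on_Pair[OF continuous_on_fst[OF continuous_on_id]])
  moreover have "t(0 := r (t 0)) \<in> PiE {..<n} (\<lambda>_. {0..1})" if "t \<in> PiE {..<n} (\<lambda>_. {0..1})" for t
    using unit_cube_update[of t n "r (t 0)"] that n r(2) unfolding topspace_unit_cube by blast
  then have "(\<lambda>x. (fst x, (snd x)(0 := r (snd x 0)))) \<in> ?S \<rightarrow> ?S"
    by (intro funcsetI) (simp add: mem_Times_iff)
  ultimately show ?thesis
    unfolding prod_unit_interval_cube case_prod_unfold continuous_map_subtopology_eu by (rule conjI)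
qed

lemma continuous_map_unit_cube_projection:
  "continuous_map (unit_cube n) euclideanreal (\<lambda>t. t i)"
  unfolding unit_cube_eq_top_of_set
  by (simp add: continuous_on_product_then_coordinatewise[OF continuous_on_id])

lemma cube_homotopic_concat:
  assumes n: "0 < n" and ab: "cube_homotopic n X p a a'" "cube_homotopic n X p b b'"
  shows "cube_homotopic n X p (cube_concat a b) (cube_concat a' b')"
proof -
  let ?C = "topspace (unit_cube n)" and ?Q = "prod_topology (top_of_set {0..1::real}) (unit_cube n)"
  obtain h where h: "continuous_map ?Q X h"
      "\<forall>t\<in>?C. h (0, t) = a t" "\<forall>t\<in>?C. h (1, t) = a' t"
      "\<forall>s\<in>{0..1}. \<forall>t\<in>cube_boundary n. h (s, t) = p"
    using ab(1) unfolding cube_homotopic_iff by (elim exE conjE)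
  obtain g where g: "continuous_map ?Q X g"
      "\<forall>t\<in>?C. g (0, t) = b t" "\<forall>t\<in>?C. g (1, t) = b' t"
      "\<forall>s\<in>{0..1}. \<forall>t\<in>cube_boundary n. g (s, t) = p"
    using ab(2) unfolding cube_homotopic_iff by (elim exE conjE)
  define lo hi :: "real \<times> (nat \<Rightarrow> real) \<Rightarrow> real \<times> (nat \<Rightarrow> real)"
    where "lo = (\<lambda>(s, t). (s, t(0 := min 1 (max 0 (2 * t 0)))))"
      and "hi = (\<lambda>(s, t). (s, t(0 := min 1 (max 0 (2 * t 0 - 1)))))"
  have lo: "continuous_map ?Q ?Q lo"
    unfolding lo_def
    by (rule continuous_map_reparametrize_first[OF n, where r = "\<lambda>u. min 1 (max 0 (2 * u))"])
      (auto intro!: continuous_intros)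
  have hi: "continuous_map ?Q ?Q hi"
    unfolding hi_def
    by (rule continuous_map_reparametrize_first[OF n, where r = "\<lambda>u. min 1 (max 0 (2 * u - 1))"])
      (auto intro!: continuous_intros)
  define H where "H = (\<lambda>x. if snd x 0 \<le> 1/2 then (h \<circ> lo) x else (g \<circ> hi) x)"
  have 1: "continuous_map ?Q X H"
    unfolding H_def
  proof (rule continuous_map_cases_le)
    show "continuous_map ?Q euclideanreal (\<lambda>x. snd x 0)"
      by (rule continuous_map_compose[OF continuous_map_snd continuous_map_unit_cube_projection, unfolded o_def])
    show "continuous_map (subtopology ?Q {x \<in> topspace ?Q. snd x 0 \<le> 1/2}) X (h \<circ> lo)"
      by (rule continuous_map_from_subtopology[OF continuous_map_compose[OF lo h(1)]])
    show "continuous_map (subtopology ?Q {x \<in> topspace ?Q. 1/2 \<le> snd x 0}) X (g \<circ> hi)"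
      by (rule continuous_map_from_subtopology[OF continuous_map_compose[OF hi g(1)]])
    fix x assume x: "x \<in> topspace ?Q" "snd x 0 = 1/2"
    then have "snd (lo x) \<in> cube_boundary n" "snd (hi x) \<in> cube_boundary n"
      using n by (auto simp: lo_def hi_def case_prod_unfold cube_boundary_def unit_cube_update)
    then show "(h \<circ> lo) x = (g \<circ> hi) x"
      using h(4) g(4) x by (auto simp: lo_def hi_def case_prod_unfold)
  qed simp
  have t0: "0 \<le> t 0 \<and> t 0 \<le> 1" if "t \<in> ?C" for t
    using n that unfolding topspace_unit_cube PiE_iff by simp
  have 2: "H (0, t) = cube_concat a b t \<and> H (1, t) = cube_concat a' b' t" if t: "t \<in> ?C" for t
  proof -
    have "h (lo (0, t)) = a (t(0 := 2 * t 0)) \<and> h (lo (1, t)) = a' (t(0 := 2 * t 0))" if "t 0 \<le> 1/2"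
      using h(2,3) unit_cube_update[OF t n, of "2 * t 0"] t0[OF t] that by (simp add: lo_def)
    moreover have "g (hi (0, t)) = b (t(0 := 2 * t 0 - 1)) \<and> g (hi (1, t)) = b' (t(0 := 2 * t 0 - 1))"
      if "\<not> t 0 \<le> 1/2"
      using g(2,3) unit_cube_update[OF t n, of "2 * t 0 - 1"] t0[OF t] that by (simp add: hi_def)
    ultimately show ?thesis by (simp add: H_def cube_concat_def)
  qed
  have 3: "H (s, t) = p" if s: "s \<in> {0..1}" and t: "t \<in> cube_boundary n" for s t
  proof -
    have t': "t \<in> ?C" using t cube_boundary_subset by blast
    obtain i where i: "i < n" "t i = 0 \<or> t i = 1" using t by (auto simp: cube_boundary_def)
    have "snd (lo (s, t)) \<in> cube_boundary n" if "t 0 \<le> 1/2"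
      using n i t' t0[OF t'] that
      by (cases "i = 0") (auto simp: lo_def cube_boundary_def unit_cube_update intro!: exI[of _ i])
    moreover have "snd (hi (s, t)) \<in> cube_boundary n" if "\<not> t 0 \<le> 1/2"
      using n i t' t0[OF t'] that
      by (cases "i = 0") (auto simp: hi_def cube_boundary_def unit_cube_update intro!: exI[of _ i])
    ultimately show ?thesis
      using s by (auto simp: H_def lo_def hi_def h(4) g(4))
  qed
  show ?thesis
    unfolding cube_homotopic_iff using 1 2 3 by blast
qed

lemma compose_cube_concat: "f \<circ> cube_concat a b = cube_concat (f \<circ> a) (f \<circ> b)"
  by (auto simp: cube_concat_def)

lemma mult_cube_class:
  assumes "0 < n" "cube_map n X p a" "cube_map n X p b"
  shows "cube_class n X p a \<otimes>\<^bsub>homotopy_group n X p\<^esub> cube_class n X p b =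
    cube_class n X p (cube_concat a b)"
proof (intro equalityI subsetI)
  fix c assume "c \<in> cube_class n X p a \<otimes>\<^bsub>homotopy_group n X p\<^esub> cube_class n X p b"
  then obtain a' b' where "cube_homotopic n X p a a'" "cube_homotopic n X p b b'"
      "cube_homotopic n X p (cube_concat a' b') c"
    by (auto simp: homotopy_group_def cube_class_def)
  then have "cube_homotopic n X p (cube_concat a b) c"
    using cube_homotopic_concat[OF assms(1), of X p a a' b b'] cube_homotopic_trans by metis
  then show "c \<in> cube_class n X p (cube_concat a b)"
    by (simp add: cube_class_def)
next
  fix c assume "c \<in> cube_class n X p (cube_concat a b)"
  moreover have "a \<in> cube_class n X p a" "b \<in> cube_class n X p b"
    using assms by (simp_all add: cube_class_def)
  ultimately show "c \<in> cube_class n X p a \<otimes>\<^bsub>homotopy_group n X p\<^esub> cube_class n X p b"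
    unfolding homotopy_group_def by (auto simp del: cube_homotopic_refl simp: cube_class_def)
qed

lemma cube_map_concat:
  assumes "0 < n" "cube_map n X p a" "cube_map n X p b"
  shows "cube_map n X p (cube_concat a b)"
  using cube_homotopic_concat[of n X p a a b b] assms by simp

lemma homotopy_group_map_hom:
  assumes n: "0 < n" and f: "based_self_map X p f"
  shows "homotopy_group_map n X p f \<in> hom (homotopy_group n X p) (homotopy_group n X p)"
proof (rule homI)
  fix A assume "A \<in> carrier (homotopy_group n X p)"
  then show "homotopy_group_map n X p f A \<in> carrier (homotopy_group n X p)"
    using f by (auto simp: homotopy_group_def homotopy_group_map_class cube_map_compose)
next
  fix A B assume "A \<in> carrier (homotopy_group n X p)" "B \<in> carrier (homotopy_group n X p)"
  then obtain a b where [simp]: "A = cube_class n X p a" "B = cube_class n X p b"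
      and ab [simp]: "cube_map n X p a" "cube_map n X p b"
    by (auto simp: homotopy_group_def)
  show "homotopy_group_map n X p f (A \<otimes>\<^bsub>homotopy_group n X p\<^esub> B) =
      homotopy_group_map n X p f A \<otimes>\<^bsub>homotopy_group n X p\<^esub> homotopy_group_map n X p f B"
    using n f by (simp add: mult_cube_class homotopy_group_map_class cube_map_concat
        cube_map_compose compose_cube_concat)
qed

text \<open>A based map always induces homomorphisms, so only bijectivity matters, in degree 0 as well.\<close>

lemma induces_homotopy_iso_iff:
  assumes "based_self_map X p f"
  shows "induces_homotopy_iso n X p f \<longleftrightarrow>
    bij_betw (homotopy_group_map n X p f)
      (carrier (homotopy_group n X p)) (carrier (homotopy_group n X p))"
  using homotopy_group_map_hom[OF _ assms] by (auto simp: induces_homotopy_iso_def iso_def)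

text \<open>Together with \<open>homotopy_group_map_id\<close> this is functoriality: homotopy inverse maps induce
  inverse bijections.\<close>

lemma homotopy_group_map_compose:
  assumes "based_self_map X p f" "based_self_map X p g" "A \<in> carrier (homotopy_group n X p)"
  shows "homotopy_group_map n X p g (homotopy_group_map n X p f A) = homotopy_group_map n X p (g \<circ> f) A"
  using assms based_self_map_compose[OF assms(1,2)]
  by (auto simp: homotopy_group_def homotopy_group_map_class cube_map_compose o_assoc)

lemma homotopy_group_map_id:
  assumes "A \<in> carrier (homotopy_group n X p)"
  shows "homotopy_group_map n X p id A = A"
  using assms by (auto simp: homotopy_group_def homotopy_group_map_class based_self_map_id)

lemma based_self_equivalence_induces_homotopy_iso:
  assumes "based_self_equivalence X p f"
  shows "induces_homotopy_iso n X p f"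
proof -
  obtain g where fg: "based_self_map X p f" "based_self_map X p g"
      "based_homotopic X p (g \<circ> f) id" "based_homotopic X p (f \<circ> g) id"
    using assms by (auto simp: based_self_equivalence_def)
  let ?G = "carrier (homotopy_group n X p)"
  have closed: "homotopy_group_map n X p h A \<in> ?G" if "based_self_map X p h" "A \<in> ?G" for h A
    using that by (auto simp: homotopy_group_def homotopy_group_map_class cube_map_compose)
  have "homotopy_group_map n X p g (homotopy_group_map n X p f A) = A"
       "homotopy_group_map n X p f (homotopy_group_map n X p g A) = A" if "A \<in> ?G" for A
    using fg that by (simp_all add: homotopy_group_map_compose homotopy_group_map_homotopic[where g=id]
        homotopy_group_map_id)
  then have "bij_betw (homotopy_group_map n X p f) ?G ?G"
    by (intro bij_betwI[where g = "homotopy_group_map n X p g"]) (auto simp: closed fg)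
  then show ?thesis
    using fg by (simp add: induces_homotopy_iso_iff)
qed

section \<open>Spaces that are a cube with collapsed boundary\<close>

definition collapse_map :: "nat \<Rightarrow> 'a topology \<Rightarrow> 'a \<Rightarrow> ((nat \<Rightarrow> real) \<Rightarrow> 'a) \<Rightarrow> bool" where
  "collapse_map n X p q \<longleftrightarrow>
     cube_map n X p q \<and> q ` topspace (unit_cube n) = topspace X \<and>
     inj_on q (topspace (unit_cube n) - cube_boundary n) \<and>
     (\<forall>t\<in>topspace (unit_cube n). q t = p \<longrightarrow> t \<in> cube_boundary n)"

lemma collapse_map_fibres:
  assumes "collapse_map n X p q" "s \<in> topspace (unit_cube n)" "t \<in> topspace (unit_cube n)" "q s = q t"
  shows "s = t \<or> s \<in> cube_boundary n \<and> t \<in> cube_boundary n"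
  using assms unfolding collapse_map_def cube_map_def inj_on_def by (metis DiffI)

lemma collapse_map_base_point:
  assumes "collapse_map n X p q" "p \<in> topspace X"
  shows "p \<in> q ` cube_boundary n"
proof -
  have "p \<in> q ` topspace (unit_cube n)"
    using assms by (simp add: collapse_map_def)
  then obtain t where t: "p = q t" "t \<in> topspace (unit_cube n)" by (rule imageE)
  then have "t \<in> cube_boundary n"
    using assms(1) by (simp add: collapse_map_def)
  with t(1) show ?thesis by (rule image_eqI)
qed

text \<open>A continuous surjection from a compact space to a Hausdorff space is a quotient map, so
  \<open>X\<close> is the quotient of the cube by its boundary and cube maps descend to it.\<close>

lemma cube_map_factors:
  assumes X: "Hausdorff_space X" and q: "collapse_map n X p q" and p: "p \<in> topspace X"
    and a: "cube_map n X p a"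
  obtains g where "based_self_map X p g" "cube_homotopic n X p a (g \<circ> q)"
proof -
  have qm: "quotient_map (unit_cube n) X q"
    using q X by (intro continuous_imp_quotient_map compact_space_unit_cube)
      (auto simp: collapse_map_def cube_map_def)
  have a_fib: "a s = a t" if "s \<in> topspace (unit_cube n)" "t \<in> topspace (unit_cube n)" "q s = q t" for s t
    using collapse_map_fibres[OF q that] a by (auto simp: cube_map_def)
  have a_cont: "continuous_map (unit_cube n) X a"
    using a by (simp add: cube_map_def)
  obtain g where g: "continuous_map X X g" "g ` topspace X = a ` topspace (unit_cube n)"
      "\<And>t. t \<in> topspace (unit_cube n) \<Longrightarrow> g (q t) = a t"
    by (rule quotient_map_lift_exists[OF qm a_cont a_fib], assumption+) (rule that)
  have gp: "g p = p"
    using collapse_map_base_point[OF q p] g(3) a cube_boundary_subset by (force simp: cube_map_def)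
  have bg: "based_self_map X p g" using g(1) gp by (simp add: based_self_map_def)
  have "cube_homotopic n X p a (g \<circ> q)"
    unfolding cube_homotopic_def
    by (rule homotopic_with_equal) (use a g q gp in \<open>auto simp: cube_map_def collapse_map_def\<close>)
  with bg that show ?thesis by blast
qed

text \<open>The same argument one dimension higher: \<open>id \<times> q\<close> is again a quotient map, because the cylinder
  over the cube is compact, and a homotopy rel boundary is constant on its fibres.\<close>

lemma based_homotopic_if_collapse_homotopic:
  assumes X: "Hausdorff_space X" and q: "collapse_map n X p q" and p: "p \<in> topspace X"
    and fg: "based_self_map X p f" "based_self_map X p g" "cube_homotopic n X p (f \<circ> q) (g \<circ> q)"
  shows "based_homotopic X p f g"
proof -
  let ?I = "top_of_set {0..1::real}" and ?C = "topspace (unit_cube n)"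
  let ?q = "\<lambda>(s, t). (id s, q t)"
  have im: "q ` ?C = topspace X" and qc: "continuous_map (unit_cube n) X q"
    using q by (auto simp: collapse_map_def cube_map_def)
  have qm: "quotient_map (prod_topology ?I (unit_cube n)) (prod_topology ?I X) ?q"
  proof (rule continuous_imp_quotient_map)
    show "continuous_map (prod_topology ?I (unit_cube n)) (prod_topology ?I X) ?q"
      using qc by (auto simp: continuous_map_prod_top)
    show "compact_space (prod_topology ?I (unit_cube n))"
      by (simp add: compact_space_prod_topology compact_space_unit_cube compact_space_subtopology)
    show "Hausdorff_space (prod_topology ?I X)"
      by (simp add: Hausdorff_space_prod_topology X Hausdorff_space_subtopology)
    show "?q ` topspace (prod_topology ?I (unit_cube n)) = topspace (prod_topology ?I X)"
      using im by force
  qed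
  obtain h where h: "continuous_map (prod_topology ?I (unit_cube n)) X h"
      "\<forall>t\<in>?C. h (0, t) = (f \<circ> q) t" "\<forall>t\<in>?C. h (1, t) = (g \<circ> q) t"
      "\<forall>s\<in>{0..1}. \<forall>t\<in>cube_boundary n. h (s, t) = p"
    using fg(3) unfolding cube_homotopic_iff by (elim exE conjE)
  have h_fib: "h x = h y" if "x \<in> topspace (prod_topology ?I (unit_cube n))"
      "y \<in> topspace (prod_topology ?I (unit_cube n))" "?q x = ?q y" for x y
    using that collapse_map_fibres[OF q, of "snd x" "snd y"] h(4) by (cases x; cases y) force
  obtain k where k: "continuous_map (prod_topology ?I X) X k"
      "k ` topspace (prod_topology ?I X) = h ` topspace (prod_topology ?I (unit_cube n))"
      "\<And>x. x \<in> topspace (prod_topology ?I (unit_cube n)) \<Longrightarrow> k (?q x) = h x"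
    by (rule quotient_map_lift_exists[OF qm h(1) h_fib], assumption+) (rule that)
  have k': "k (s, q t) = h (s, t)" if "s \<in> {0..1}" "t \<in> ?C" for s t
    using k(3)[of "(s, t)"] that by simp
  have "k (0, x) = f x \<and> k (1, x) = g x" if "x \<in> topspace X" for x
  proof -
    obtain t where "x = q t" "t \<in> ?C"
      using \<open>x \<in> topspace X\<close> unfolding im[symmetric] by (rule imageE)
    then show ?thesis using h(2,3) k' by simp
  qed
  moreover have "k (s, p) = p" if "s \<in> {0..1}" for s
  proof -
    obtain t where t: "p = q t" "t \<in> cube_boundary n"
      using collapse_map_base_point[OF q p] by (rule imageE)
    then have "t \<in> ?C" using cube_boundary_subset by blast
    with t show ?thesis using that h(4) k'[of s t] by simp
  qed
  ultimately show ?thesis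
    unfolding based_homotopic_iff[OF p] using k(1) by blast
qed

text \<open>Surjectivity of \<open>f\<^sub>*\<close> at the class of \<open>q\<close> gives a right homotopy inverse \<open>g\<close>. Both \<open>g \<circ> f \<circ> q\<close>
  and \<open>q\<close> then have the same image under \<open>f\<^sub>*\<close>, so injectivity makes \<open>g\<close> a left inverse.\<close>

lemma homotopy_iso_imp_based_self_equivalence:
  assumes X: "Hausdorff_space X" and q: "collapse_map n X p q" and p: "p \<in> topspace X"
    and f: "based_self_map X p f" and iso: "induces_homotopy_iso n X p f"
  shows "based_self_equivalence X p f"
proof -
  let ?G = "carrier (homotopy_group n X p)"
  have bij: "bij_betw (homotopy_group_map n X p f) ?G ?G"
    using iso f by (simp add: induces_homotopy_iso_iff)
  have q': "cube_map n X p q" using q by (simp add: collapse_map_def)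
  then have "cube_class n X p q \<in> homotopy_group_map n X p f ` ?G"
    using bij by (auto simp: bij_betw_def homotopy_group_def)
  then obtain a where a: "cube_map n X p a" "cube_class n X p q = cube_class n X p (f \<circ> a)"
    using f by (auto simp: homotopy_group_def homotopy_group_map_class)
  obtain g where g: "based_self_map X p g" "cube_homotopic n X p a (g \<circ> q)"
    by (rule cube_map_factors[OF X q p a(1)])
  have fg: "based_self_map X p (f \<circ> g)" and gf: "based_self_map X p (g \<circ> f)"
    and i: "based_self_map X p id"
    using f g by (simp_all add: based_self_map_compose based_self_map_id)
  have "cube_homotopic n X p (f \<circ> a) (f \<circ> (g \<circ> q))"
    using cube_homotopic_compose_left[OF f g(2)] .
  moreover have "cube_homotopic n X p q (f \<circ> a)"
    using a(2) q' by (simp add: cube_class_eq_iff)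
  ultimately have "cube_homotopic n X p (f \<circ> g \<circ> q) (id \<circ> q)"
    by (metis cube_homotopic_sym cube_homotopic_trans comp_assoc id_comp)
  then have fg_id: "based_homotopic X p (f \<circ> g) id"
    by (rule based_homotopic_if_collapse_homotopic[OF X q p fg i])
  have "cube_homotopic n X p ((f \<circ> g) \<circ> (f \<circ> q)) (id \<circ> (f \<circ> q))"
    by (rule cube_homotopic_compose_right[OF fg_id cube_map_compose[OF f q']])
  then have "cube_homotopic n X p (f \<circ> (g \<circ> f \<circ> q)) (f \<circ> q)"
    by (simp add: comp_assoc)
  then have "cube_class n X p (f \<circ> (g \<circ> f \<circ> q)) = cube_class n X p (f \<circ> q)"
    by (simp add: cube_class_eq_iff cube_homotopic_imp_cube_map)
  then have "homotopy_group_map n X p f (cube_class n X p (g \<circ> f \<circ> q)) =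
      homotopy_group_map n X p f (cube_class n X p q)"
    using f q' gf by (simp add: homotopy_group_map_class cube_map_compose)
  moreover have "cube_class n X p (g \<circ> f \<circ> q) \<in> ?G" "cube_class n X p q \<in> ?G"
    using q' cube_map_compose[OF gf q'] by (auto simp: homotopy_group_def)
  ultimately have "cube_class n X p (g \<circ> f \<circ> q) = cube_class n X p q"
    using bij by (meson bij_betw_def inj_onD)
  then have "cube_homotopic n X p (g \<circ> f \<circ> q) (id \<circ> q)"
    using cube_map_compose[OF gf q'] by (simp add: cube_class_eq_iff)
  then have "based_homotopic X p (g \<circ> f) id"
    by (rule based_homotopic_if_collapse_homotopic[OF X q p gf i])
  with fg_id f g(1) show ?thesis
    unfolding based_self_equivalence_def by blast
qed

section \<open>Spheres and reflections\<close>

definition dotp :: "nat \<Rightarrow> (nat \<Rightarrow> real) \<Rightarrow> (nat \<Rightarrow> real) \<Rightarrow> real" where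
  "dotp k x y = (\<Sum>i\<le>k. x i * y i)"

definition unit_sphere :: "nat \<Rightarrow> (nat \<Rightarrow> real) set" where
  "unit_sphere k = {x. dotp k x x = 1 \<and> (\<forall>i>k. x i = 0)}"

lemma nsphere_eq_top_of_set: "nsphere k = top_of_set (unit_sphere k)"
  by (simp add: nsphere unit_sphere_def dotp_def power2_eq_square euclidean_product_topology)

lemma topspace_nsphere_eq: "topspace (nsphere k) = unit_sphere k"
  by (simp add: nsphere_eq_top_of_set)

lemma continuous_map_into_nsphere:
  "continuous_map X (nsphere k) f \<longleftrightarrow>
    (\<forall>i. continuous_map X euclideanreal (\<lambda>x. f x i)) \<and> f \<in> topspace X \<rightarrow> unit_sphere k"
  using continuous_map_componentwise_UNIV[of X "\<lambda>_. euclideanreal" f]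
  by (auto simp: nsphere_eq_top_of_set continuous_map_in_subtopology euclidean_product_topology
      image_subset_iff_funcset)

lemma Hausdorff_space_nsphere: "Hausdorff_space (nsphere k)"
  by (simp add: nsphere_eq_top_of_set Hausdorff_space_subtopology)

lemma dotp_commute: "dotp k x y = dotp k y x"
  by (simp add: dotp_def mult.commute)

lemma dotp_diff_left: "dotp k (\<lambda>i. x i - y i) z = dotp k x z - dotp k y z"
  by (simp add: dotp_def left_diff_distrib sum_subtractf)

lemma dotp_diff_right: "dotp k z (\<lambda>i. x i - y i) = dotp k z x - dotp k z y"
  by (simp add: dotp_def right_diff_distrib sum_subtractf)

lemma dotp_add_right: "dotp k z (\<lambda>i. x i + y i) = dotp k z x + dotp k z y"
  by (simp add: dotp_def distrib_left sum.distrib)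

lemma dotp_scale_left: "dotp k (\<lambda>i. c * x i) y = c * dotp k x y"
  by (simp add: dotp_def sum_distrib_left mult.assoc)

lemma dotp_scale_right: "dotp k x (\<lambda>i. c * y i) = c * dotp k x y"
  by (simp add: dotp_def sum_distrib_left mult.left_commute)

lemmas dotp_simps = dotp_diff_left dotp_diff_right dotp_add_right dotp_scale_left dotp_scale_right

lemma dotp_self_nonneg: "0 \<le> dotp k x x"
  by (simp add: dotp_def sum_nonneg)

lemma dotp_self_eq_0: "dotp k x x = 0 \<longleftrightarrow> (\<forall>i\<le>k. x i = 0)"
  unfolding dotp_def by (subst sum_nonneg_eq_0_iff) auto

text \<open>Strict Cauchy-Schwarz for distinct unit vectors, from \<open>\<bar>y - x\<bar>\<^sup>2 = 2 - 2 (x \<bullet> y)\<close>.\<close>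

lemma dotp_unit_sphere_less_1:
  assumes "x \<in> unit_sphere k" "y \<in> unit_sphere k" "x \<noteq> y"
  shows "dotp k x y < 1"
proof (rule ccontr)
  assume "\<not> dotp k x y < 1"
  moreover have "dotp k (\<lambda>i. y i - x i) (\<lambda>i. y i - x i) = 2 - 2 * dotp k x y"
    using assms by (simp add: dotp_simps dotp_commute[of k y x] unit_sphere_def)
  ultimately have "dotp k (\<lambda>i. y i - x i) (\<lambda>i. y i - x i) = 0"
    using dotp_self_nonneg[of k "\<lambda>i. y i - x i"] by linarith
  then have "y i = x i" for i
    using assms(1,2) by (cases "i \<le> k") (simp_all add: dotp_self_eq_0 unit_sphere_def)
  then have "y = x" by (rule ext)
  with assms(3) show False by simp
qed

lemma continuous_map_dotp:
  assumes "\<And>i. continuous_map X euclideanreal (\<lambda>x. f x i)" "\<And>i. continuous_map X euclideanreal (\<lambda>x. g x i)"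
  shows "continuous_map X euclideanreal (\<lambda>x. dotp k (f x) (g x))"
  unfolding dotp_def using assms by (auto intro!: continuous_map_sum continuous_map_real_mult)

text \<open>The reflection of \<open>x\<close> in the hyperplane orthogonal to \<open>w\<close>. For \<open>w = 0\<close> division by zero makes
  it the identity, so that exchanging two points by a reflection includes the case that they are equal.\<close>

definition reflect :: "nat \<Rightarrow> (nat \<Rightarrow> real) \<Rightarrow> (nat \<Rightarrow> real) \<Rightarrow> nat \<Rightarrow> real" where
  "reflect k w x = (\<lambda>i. x i - 2 * dotp k w x / dotp k w w * w i)"

lemma dotp_reflect: "dotp k (reflect k w x) (reflect k w x) = dotp k x x"
proof (cases "dotp k w w = 0")
  case False
  define c where "c = 2 * dotp k w x / dotp k w w"
  have "dotp k (\<lambda>i. x i - c * w i) (\<lambda>i. x i - c * w i) =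
      dotp k x x + c * (c * dotp k w w - 2 * dotp k w x)"
    by (simp add: dotp_simps dotp_commute[of k x w] algebra_simps)
  also have "c * dotp k w w - 2 * dotp k w x = 0"
    using False by (simp add: c_def)
  finally show ?thesis by (simp add: reflect_def c_def)
qed (simp add: reflect_def)

lemma reflect_unit_sphere:
  "x \<in> unit_sphere k \<Longrightarrow> (\<And>i. i > k \<Longrightarrow> w i = 0) \<Longrightarrow> reflect k w x \<in> unit_sphere k"
  by (simp add: unit_sphere_def dotp_reflect) (simp add: reflect_def)

lemma reflect_involution: "reflect k w (reflect k w x) = x"
proof (cases "dotp k w w = 0")
  case False
  define c where "c = 2 * dotp k w x / dotp k w w"
  have eq: "reflect k w x = (\<lambda>i. x i - c * w i)"
    by (simp add: reflect_def c_def)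
  have "dotp k w (reflect k w x) = - dotp k w x"
    using False unfolding eq by (simp add: dotp_simps) (simp add: c_def)
  then show ?thesis
    unfolding reflect_def[of k w "reflect k w x"] by (simp add: eq) (simp add: c_def)
qed (simp add: reflect_def)

text \<open>The hyperplane orthogonal to \<open>y - x\<close> is the perpendicular bisector of \<open>x\<close> and \<open>y\<close>, as both have
  norm one.\<close>

lemma reflect_swap:
  assumes "x \<in> unit_sphere k" "y \<in> unit_sphere k"
  shows "reflect k (\<lambda>i. y i - x i) x = y"
proof (cases "x = y")
  case False
  then have "dotp k (\<lambda>i. y i - x i) (\<lambda>i. y i - x i) \<noteq> 0"
    using assms unfolding dotp_self_eq_0 unit_sphere_def by (auto simp: fun_eq_iff) (metis not_le)
  moreover have "dotp k (\<lambda>i. y i - x i) (\<lambda>i. y i - x i) = - 2 * dotp k (\<lambda>i. y i - x i) x"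
    using assms by (simp add: dotp_simps unit_sphere_def dotp_commute[of k x y])
  ultimately show ?thesis
    by (simp add: reflect_def fun_eq_iff)
qed (simp add: reflect_def dotp_def)

lemma reflect_scale: "c \<noteq> 0 \<Longrightarrow> reflect k (\<lambda>i. c * w i) x = reflect k w x"
  by (simp add: reflect_def dotp_simps mult_ac)

lemma continuous_map_reflect_const:
  assumes "\<And>i. continuous_map X euclideanreal (\<lambda>t. x t i)"
  shows "continuous_map X euclideanreal (\<lambda>t. reflect k w (x t) i)"
proof -
  have "continuous_map X euclideanreal (\<lambda>t. x t i - (2 / dotp k w w * w i) * dotp k w (x t))"
    using assms by (intro continuous_map_diff continuous_map_real_mult continuous_map_dotp) auto
  then show ?thesis by (simp add: reflect_def mult_ac)
qed

lemma continuous_map_reflect: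
  assumes "\<And>i. continuous_map X euclideanreal (\<lambda>t. w t i)" "\<And>i. continuous_map X euclideanreal (\<lambda>t. x t i)"
    and "\<And>t. t \<in> topspace X \<Longrightarrow> dotp k (w t) (w t) \<noteq> 0"
  shows "continuous_map X euclideanreal (\<lambda>t. reflect k (w t) (x t) i)"
  unfolding reflect_def using assms
  by (intro continuous_map_diff continuous_map_real_mult continuous_map_real_divide
      continuous_map_dotp continuous_map_const[THEN iffD2]) auto

section \<open>The sphere as a cube with collapsed boundary\<close>

text \<open>A function on \<open>[-1, 1]\<^sup>k\<close> that is positive inside and vanishes on the boundary. Truncation at 0
  extends it to all of space, which the intermediate value argument below uses.\<close>

definition bump :: "nat \<Rightarrow> (nat \<Rightarrow> real) \<Rightarrow> real" where
  "bump k u = (\<Prod>i<k. max 0 (1 - (u i)\<^sup>2))"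

lemma bump_nonneg: "0 \<le> bump k u"
  by (simp add: bump_def prod_nonneg)

lemma bump_le_1: "bump k u \<le> 1"
  by (simp add: bump_def prod_le_1)

lemma bump_pos_iff: "0 < bump k u \<longleftrightarrow> (\<forall>i<k. \<bar>u i\<bar> < 1)"
proof -
  have "max 0 (1 - (u i)\<^sup>2) = 0 \<longleftrightarrow> \<not> \<bar>u i\<bar> < 1" for i
    unfolding abs_square_less_1[symmetric] by (simp add: max_def)
  then have "bump k u = 0 \<longleftrightarrow> (\<exists>i<k. \<not> \<bar>u i\<bar> < 1)"
    unfolding bump_def by (subst prod_zero_iff) auto
  then show ?thesis
    using bump_nonneg[of k u] unfolding less_le by metis
qed

lemma bump_antimono:
  assumes "\<And>i. i < k \<Longrightarrow> \<bar>u i\<bar> \<le> \<bar>v i\<bar>" shows "bump k v \<le> bump k u"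
  unfolding bump_def
proof (rule prod_mono)
  fix i assume "i \<in> {..<k}"
  then have "(u i)\<^sup>2 \<le> (v i)\<^sup>2" using assms by (simp add: abs_le_square_iff)
  then show "0 \<le> max 0 (1 - (v i)\<^sup>2) \<and> max 0 (1 - (v i)\<^sup>2) \<le> max 0 (1 - (u i)\<^sup>2)" by auto
qed

text \<open>With \<open>u = s v\<close> the equation reads \<open>u / bump u = v\<close>. So this lemma and the next one say that
  \<open>u \<mapsto> u / bump u\<close> is a bijection from the open cube to Euclidean space. Uniqueness holds because the
  bump does not increase along a ray.\<close>

lemma bump_ray_exists:
  obtains s where "0 < s" "s = bump k (\<lambda>i. s * v i)"
proof -
  have "\<exists>s\<ge>0. s \<le> 1 \<and> s - bump k (\<lambda>i. s * v i) = 0"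
  proof (rule IVT')
    show "continuous_on {0..1} (\<lambda>s. s - bump k (\<lambda>i. s * v i))"
      unfolding bump_def by (intro continuous_intros)
  qed (use bump_le_1 in \<open>auto simp: bump_def\<close>)
  then obtain s where s: "0 \<le> s" "s = bump k (\<lambda>i. s * v i)" by auto
  moreover have "s \<noteq> 0"
    using s(2) by (auto simp: bump_def)
  ultimately show ?thesis using that by force
qed

lemma bump_ray_unique:
  assumes "0 < s" "s = bump k (\<lambda>i. s * v i)" "0 < s'" "s' = bump k (\<lambda>i. s' * v i)"
  shows "s = s'"
proof -
  have *: "\<not> s < s'" if "0 < s" "s = bump k (\<lambda>i. s * v i)" "s' = bump k (\<lambda>i. s' * v i)" for s s'
  proof
    assume "s < s'"
    then have "bump k (\<lambda>i. s' * v i) \<le> bump k (\<lambda>i. s * v i)"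
      using that by (intro bump_antimono) (simp add: abs_mult mult_right_mono)
    with that \<open>s < s'\<close> show False by linarith
  qed
  show ?thesis using *[of s s'] *[of s' s] assms by linarith
qed

text \<open>The cube is recentred to \<open>[-1, 1]\<^sup>k\<close>. The vector \<open>(u, - bump u)\<close> is the direction of a line
  through the north pole; it is never zero and is horizontal, hence tangent to the sphere,
  exactly on the boundary.\<close>

definition cube_direction :: "nat \<Rightarrow> (nat \<Rightarrow> real) \<Rightarrow> nat \<Rightarrow> real" where
  "cube_direction k t i = (if i < k then 2 * t i - 1 else if i = k then - bump k (\<lambda>i. 2 * t i - 1) else 0)"

definition pole :: "nat \<Rightarrow> nat \<Rightarrow> real" where
  "pole k = (\<lambda>i. if i = k then 1 else 0)"

lemma pole_unit_sphere: "pole k \<in> unit_sphere k"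
  by (simp add: pole_def unit_sphere_def dotp_def if_distrib cong: if_cong)

lemma dotp_pole: "dotp k w (pole k) = w k"
  by (simp add: dotp_def pole_def if_distrib cong: if_cong)

lemma cube_direction_nonzero: "dotp k (cube_direction k t) (cube_direction k t) \<noteq> 0"
proof
  assume "dotp k (cube_direction k t) (cube_direction k t) = 0"
  then have 0: "\<forall>i\<le>k. cube_direction k t i = 0" by (simp add: dotp_self_eq_0)
  have "2 * t i - 1 = 0" if "i < k" for i
    using 0[rule_format, of i] that by (simp add: cube_direction_def)
  then have "0 < bump k (\<lambda>i. 2 * t i - 1)" by (simp add: bump_pos_iff)
  with 0 show False by (auto simp: cube_direction_def)
qed

lemma cube_boundary_iff_bump:
  assumes t: "t \<in> topspace (unit_cube k)"
  shows "t \<in> cube_boundary k \<longleftrightarrow> bump k (\<lambda>i. 2 * t i - 1) = 0"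
proof -
  have t01: "0 \<le> t i" "t i \<le> 1" if "i < k" for i
    using t that unfolding topspace_unit_cube PiE_iff by auto
  have "bump k (\<lambda>i. 2 * t i - 1) = 0 \<longleftrightarrow> \<not> 0 < bump k (\<lambda>i. 2 * t i - 1)"
    using bump_nonneg[of k] by (metis less_le less_irrefl)
  also have "\<dots> \<longleftrightarrow> (\<exists>i<k. \<not> \<bar>2 * t i - 1\<bar> < 1)" by (simp add: bump_pos_iff)
  also have "\<dots> \<longleftrightarrow> (\<exists>i<k. t i = 0 \<or> t i = 1)"
  proof (intro ex_cong1 conj_cong refl)
    fix i assume "i < k"
    then show "(\<not> \<bar>2 * t i - 1\<bar> < 1) = (t i = 0 \<or> t i = 1)"
      using t01[of i] by (auto simp: abs_if)
  qed
  finally show ?thesis using t by (simp add: cube_boundary_def)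
qed

text \<open>The second intersection of the line in direction \<open>cube_direction k t\<close> through the north
  pole with the sphere. Tangent lines meet the sphere only in the pole.\<close>

definition pole_collapse :: "nat \<Rightarrow> (nat \<Rightarrow> real) \<Rightarrow> nat \<Rightarrow> real" where
  "pole_collapse k t = reflect k (cube_direction k t) (pole k)"

lemma pole_collapse_eq_pole_iff:
  "pole_collapse k t = pole k \<longleftrightarrow> bump k (\<lambda>i. 2 * t i - 1) = 0"
proof
  assume "pole_collapse k t = pole k"
  then have "cube_direction k t k * cube_direction k t k = 0"
    using cube_direction_nonzero[of k t]
    by (auto simp: pole_collapse_def reflect_def dotp_pole fun_eq_iff)
  then show "bump k (\<lambda>i. 2 * t i - 1) = 0" by (simp add: cube_direction_def)
next
  assume "bump k (\<lambda>i. 2 * t i - 1) = 0"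
  then show "pole_collapse k t = pole k"
    by (simp add: pole_collapse_def reflect_def dotp_pole cube_direction_def)
qed

text \<open>A point other than the pole determines the line through it and the pole, hence \<open>u / bump u\<close>.\<close>

lemma pole_collapse_inj:
  assumes eq: "pole_collapse k s = pole_collapse k t"
    and pos: "0 < bump k (\<lambda>i. 2 * s i - 1)" "0 < bump k (\<lambda>i. 2 * t i - 1)" and i: "i < k"
  shows "s i = t i"
proof -
  \<comment> \<open>Comparing the displacements from the pole, the two directions are proportional.\<close>
  define c where "c t = 2 * cube_direction k t k / dotp k (cube_direction k t) (cube_direction k t)" for t
  have c: "c s * cube_direction k s j = c t * cube_direction k t j" for j
    using fun_cong[OF eq, of j] by (simp add: pole_collapse_def reflect_def dotp_pole c_def)
  have c0: "c s \<noteq> 0" "c t \<noteq> 0"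
    using pos cube_direction_nonzero[of k] by (simp_all add: c_def cube_direction_def)
  define m m' where "m = bump k (\<lambda>i. 2 * s i - 1)" and "m' = bump k (\<lambda>i. 2 * t i - 1)"
  define v where "v i = (2 * t i - 1) / m'" for i
  have mm: "c s * m = c t * m'" using c[of k] by (simp add: cube_direction_def m_def m'_def)
  have s: "2 * s j - 1 = m * v j" if "j < k" for j
  proof -
    have "c s * (2 * s j - 1) = c t * (2 * t j - 1)"
      using c[of j] that by (simp add: cube_direction_def)
    also have "\<dots> = c t * m' * v j" using pos by (simp add: v_def m'_def)
    also have "\<dots> = c s * (m * v j)" by (simp flip: mm)
    finally show ?thesis using c0 by simp
  qed
  have t: "2 * t j - 1 = m' * v j" for j using pos by (simp add: v_def m'_def)
  have "bump k (\<lambda>i. 2 * s i - 1) = bump k (\<lambda>i. m * v i)"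
    unfolding bump_def by (intro prod.cong refl) (simp add: s)
  then have "m = bump k (\<lambda>i. m * v i)"
    unfolding m_def[symmetric] .
  moreover have "m' = bump k (\<lambda>i. m' * v i)"
    unfolding t[symmetric] by (rule m'_def)
  ultimately have "m = m'"
    using bump_ray_unique pos m_def m'_def by metis
  then show ?thesis using s[OF i] t[of i] by simp
qed

text \<open>For \<open>y\<close> different from the pole, the direction \<open>y - pole\<close> is scaled until its last coordinate
  is minus the bump of the others.\<close>

lemma pole_collapse_surj:
  assumes "0 < k" "y \<in> unit_sphere k"
  shows "\<exists>t\<in>topspace (unit_cube k). pole_collapse k t = y"
proof (cases "y = pole k")
  case True
  define t where "t = restrict (\<lambda>_. 0::real) {..<k}"
  have t: "t \<in> topspace (unit_cube k)" "t \<in> cube_boundary k"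
    using \<open>0 < k\<close> by (auto simp: t_def topspace_unit_cube cube_boundary_def intro!: exI[of _ 0])
  then have "pole_collapse k t = pole k"
    by (simp add: pole_collapse_eq_pole_iff cube_boundary_iff_bump)
  with t(1) True show ?thesis by blast
next
  case False
  have yk: "y k < 1"
    using dotp_unit_sphere_less_1[OF assms(2) pole_unit_sphere False] by (simp add: dotp_pole)
  define v where "v i = y i / (1 - y k)" for i
  obtain s where s: "0 < s" "s = bump k (\<lambda>i. s * v i)" by (rule bump_ray_exists)
  define t where "t = restrict (\<lambda>i. (s * v i + 1) / 2) {..<k}"
  have "\<forall>i<k. \<bar>s * v i\<bar> < 1" using s by (simp flip: bump_pos_iff)
  then have t: "t \<in> topspace (unit_cube k)"
    by (force simp: t_def topspace_unit_cube abs_less_iff)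
  have "bump k (\<lambda>i. 2 * t i - 1) = bump k (\<lambda>i. s * v i)"
    unfolding bump_def by (intro prod.cong refl) (simp add: t_def field_simps)
  then have bs: "bump k (\<lambda>i. 2 * t i - 1) = s" using s by simp
  have dir: "cube_direction k t = (\<lambda>i. s / (1 - y k) * (y i - pole k i))"
  proof
    fix i show "cube_direction k t i = s / (1 - y k) * (y i - pole k i)"
      using yk assms(2) unfolding cube_direction_def bs
      by (auto simp: t_def v_def pole_def unit_sphere_def field_simps)
  qed
  have "pole_collapse k t = reflect k (\<lambda>i. y i - pole k i) (pole k)"
    unfolding pole_collapse_def dir by (rule reflect_scale) (use yk s in simp)
  also have "\<dots> = y" by (rule reflect_swap[OF pole_unit_sphere assms(2)])
  finally show ?thesis using t by blast
qed

lemma continuous_map_pole_collapse: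
  "continuous_map (unit_cube k) euclideanreal (\<lambda>t. pole_collapse k t i)"
  unfolding pole_collapse_def
proof (rule continuous_map_reflect)
  show "continuous_map (unit_cube k) euclideanreal (\<lambda>t. cube_direction k t i)" for i
  proof -
    have *: "continuous_on (PiE {..<k} (\<lambda>_. {0..1})) (\<lambda>t::nat \<Rightarrow> real. t i)" for i
      by (rule continuous_on_product_then_coordinatewise[OF continuous_on_id])
    show ?thesis
      unfolding unit_cube_eq_top_of_set cube_direction_def bump_def
      by (cases "i < k"; cases "i = k") (auto intro!: continuous_intros *)
  qed
qed (use cube_direction_nonzero in auto)

text \<open>A reflection carries the north pole to the given base point.\<close>

lemma nsphere_collapse_map:
  assumes k: "0 < k" and p: "p \<in> unit_sphere k"
  shows "\<exists>q. collapse_map k (nsphere k) p q"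
proof -
  let ?w = "\<lambda>i. p i - pole k i"
  define q where "q t = reflect k ?w (pole_collapse k t)" for t
  have w0: "?w i = 0" if "i > k" for i
    using p pole_unit_sphere[of k] that by (simp add: unit_sphere_def)
  have Rp: "reflect k ?w (pole k) = p" by (rule reflect_swap[OF pole_unit_sphere p])
  have R_eq: "reflect k ?w x = reflect k ?w y \<longleftrightarrow> x = y" for x y
    by (metis reflect_involution)
  have qp: "q t = p \<longleftrightarrow> bump k (\<lambda>i. 2 * t i - 1) = 0" for t
    unfolding q_def using R_eq[of "pole_collapse k t" "pole k"] by (simp add: Rp pole_collapse_eq_pole_iff)
  have pc: "pole_collapse k t \<in> unit_sphere k" for t
    unfolding pole_collapse_def
    by (rule reflect_unit_sphere[OF pole_unit_sphere]) (simp add: cube_direction_def)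
  have qin: "q t \<in> unit_sphere k" for t
    unfolding q_def by (rule reflect_unit_sphere[OF pc w0])
  have qc: "continuous_map (unit_cube k) euclideanreal (\<lambda>t. q t i)" for i
    unfolding q_def by (intro continuous_map_reflect_const continuous_map_pole_collapse)
  have "cube_map k (nsphere k) p q"
    using qc qin cube_boundary_subset[of k]
    by (auto simp: cube_map_def continuous_map_into_nsphere qp cube_boundary_iff_bump subset_iff)
  moreover have "q ` topspace (unit_cube k) = topspace (nsphere k)"
  proof
    show "q ` topspace (unit_cube k) \<subseteq> topspace (nsphere k)"
      using qin by (auto simp: topspace_nsphere_eq)
    show "topspace (nsphere k) \<subseteq> q ` topspace (unit_cube k)"
    proof
      fix y assume "y \<in> topspace (nsphere k)"
      then have "reflect k ?w y \<in> unit_sphere k"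
        using reflect_unit_sphere w0 by (simp add: topspace_nsphere_eq)
      then obtain t where t: "t \<in> topspace (unit_cube k)" "pole_collapse k t = reflect k ?w y"
        using pole_collapse_surj[OF k] by blast
      then have "y = q t" by (simp only: q_def reflect_involution)
      then show "y \<in> q ` topspace (unit_cube k)"
        using t(1) by (rule image_eqI[where f = q])
    qed
  qed
  moreover have "inj_on q (topspace (unit_cube k) - cube_boundary k)"
  proof (rule inj_onI)
    fix s t assume st: "s \<in> topspace (unit_cube k) - cube_boundary k"
        "t \<in> topspace (unit_cube k) - cube_boundary k" and "q s = q t"
    then have eq: "pole_collapse k s = pole_collapse k t" by (simp add: q_def R_eq)
    have "0 < bump k (\<lambda>i. 2 * s i - 1)" "0 < bump k (\<lambda>i. 2 * t i - 1)"
      using st bump_nonneg[of k] by (auto simp: cube_boundary_iff_bump less_le)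
    then show "s = t"
      using pole_collapse_inj[OF eq] st
      by (intro extensionalityI[where A = "{..<k}"]) (auto simp: topspace_unit_cube PiE_def)
  qed
  moreover have "\<forall>t\<in>topspace (unit_cube k). q t = p \<longrightarrow> t \<in> cube_boundary k"
    by (simp add: qp cube_boundary_iff_bump)
  ultimately have "collapse_map k (nsphere k) p q" by (simp add: collapse_map_def)
  then show ?thesis by blast
qed

section \<open>Lipschitz approximation\<close>

definition cube_lipschitz :: "nat \<Rightarrow> ((nat \<Rightarrow> real) \<Rightarrow> real) \<Rightarrow> bool" where
  "cube_lipschitz n f \<longleftrightarrow>
     (\<exists>L. \<forall>s\<in>topspace (unit_cube n). \<forall>t\<in>topspace (unit_cube n).
        \<bar>f s - f t\<bar> \<le> L * (\<Sum>l<n. \<bar>s l - t l\<bar>))"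

lemma cube_lipschitzE:
  assumes "cube_lipschitz n f"
  obtains L where "0 \<le> L"
    "\<And>s t. s \<in> topspace (unit_cube n) \<Longrightarrow> t \<in> topspace (unit_cube n) \<Longrightarrow>
       \<bar>f s - f t\<bar> \<le> L * (\<Sum>l<n. \<bar>s l - t l\<bar>)"
proof -
  obtain L where L: "\<And>s t. s \<in> topspace (unit_cube n) \<Longrightarrow> t \<in> topspace (unit_cube n) \<Longrightarrow>
      \<bar>f s - f t\<bar> \<le> L * (\<Sum>l<n. \<bar>s l - t l\<bar>)"
    using assms unfolding cube_lipschitz_def by blast
  have "\<bar>f s - f t\<bar> \<le> \<bar>L\<bar> * (\<Sum>l<n. \<bar>s l - t l\<bar>)"
    if "s \<in> topspace (unit_cube n)" "t \<in> topspace (unit_cube n)" for s t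
    using L[OF that] mult_right_mono[OF abs_ge_self[of L] sum_nonneg, of "{..<n}" "\<lambda>l. \<bar>s l - t l\<bar>"]
    by simp
  then show ?thesis using that[of "\<bar>L\<bar>"] by simp
qed

lemma cube_lipschitz_bounded:
  assumes "cube_lipschitz n f"
  obtains B where "0 \<le> B" "\<And>t. t \<in> topspace (unit_cube n) \<Longrightarrow> \<bar>f t\<bar> \<le> B"
proof -
  obtain L where L: "0 \<le> L" "\<And>s t. s \<in> topspace (unit_cube n) \<Longrightarrow> t \<in> topspace (unit_cube n) \<Longrightarrow>
       \<bar>f s - f t\<bar> \<le> L * (\<Sum>l<n. \<bar>s l - t l\<bar>)"
    using assms by (rule cube_lipschitzE) (rule that)
  define origin where "origin = restrict (\<lambda>_. 0::real) {..<n}"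
  have origin: "origin \<in> topspace (unit_cube n)" by (auto simp: origin_def topspace_unit_cube)
  have "\<bar>f t\<bar> \<le> \<bar>f origin\<bar> + L * real n" if t: "t \<in> topspace (unit_cube n)" for t
  proof -
    have "\<bar>t l - origin l\<bar> \<le> 1" if "l < n" for l
      using t that unfolding topspace_unit_cube PiE_iff by (auto simp: origin_def)
    then have "(\<Sum>l<n. \<bar>t l - origin l\<bar>) \<le> real n"
      using sum_bounded_above[of "{..<n}" "\<lambda>l. \<bar>t l - origin l\<bar>" 1] by simp
    then have "L * (\<Sum>l<n. \<bar>t l - origin l\<bar>) \<le> L * real n" using L(1) by (rule mult_left_mono)
    with L(2)[OF t origin] show ?thesis by linarith
  qed
  then show ?thesis using that[of "\<bar>f origin\<bar> + L * real n"] L(1) by simp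
qed

lemma cube_lipschitz_const: "cube_lipschitz n (\<lambda>_. c)"
  unfolding cube_lipschitz_def by (rule exI[of _ 0]) simp

lemma cube_lipschitz_projection:
  assumes "i < n" shows "cube_lipschitz n (\<lambda>t. t i)"
  unfolding cube_lipschitz_def
proof (intro exI[of _ 1] ballI)
  fix s t :: "nat \<Rightarrow> real"
  show "\<bar>s i - t i\<bar> \<le> 1 * (\<Sum>l<n. \<bar>s l - t l\<bar>)"
    using assms member_le_sum[of i "{..<n}" "\<lambda>l. \<bar>s l - t l\<bar>"] by simp
qed

lemma cube_lipschitz_if_le:
  assumes "cube_lipschitz n f" "cube_lipschitz n g" "0 \<le> A" "0 \<le> B"
    and "\<And>s t. s \<in> topspace (unit_cube n) \<Longrightarrow> t \<in> topspace (unit_cube n) \<Longrightarrow>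
       \<bar>h s - h t\<bar> \<le> A * \<bar>f s - f t\<bar> + B * \<bar>g s - g t\<bar>"
  shows "cube_lipschitz n h"
proof -
  obtain L where L: "0 \<le> L" "\<And>s t. s \<in> topspace (unit_cube n) \<Longrightarrow> t \<in> topspace (unit_cube n) \<Longrightarrow>
       \<bar>f s - f t\<bar> \<le> L * (\<Sum>l<n. \<bar>s l - t l\<bar>)"
    using assms(1) by (rule cube_lipschitzE) (rule that)
  obtain K where K: "0 \<le> K" "\<And>s t. s \<in> topspace (unit_cube n) \<Longrightarrow> t \<in> topspace (unit_cube n) \<Longrightarrow>
       \<bar>g s - g t\<bar> \<le> K * (\<Sum>l<n. \<bar>s l - t l\<bar>)"
    using assms(2) by (rule cube_lipschitzE) (rule that)
  show ?thesis
    unfolding cube_lipschitz_def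
  proof (intro exI[of _ "A * L + B * K"] ballI)
    fix s t assume st: "s \<in> topspace (unit_cube n)" "t \<in> topspace (unit_cube n)"
    have "\<bar>h s - h t\<bar> \<le> A * \<bar>f s - f t\<bar> + B * \<bar>g s - g t\<bar>" by (rule assms(5)[OF st])
    also have "\<dots> \<le> A * (L * (\<Sum>l<n. \<bar>s l - t l\<bar>)) + B * (K * (\<Sum>l<n. \<bar>s l - t l\<bar>))"
      using assms(3,4) by (intro add_mono mult_left_mono L(2)[OF st] K(2)[OF st])
    finally show "\<bar>h s - h t\<bar> \<le> (A * L + B * K) * (\<Sum>l<n. \<bar>s l - t l\<bar>)"
      by (simp add: algebra_simps)
  qed
qed

lemma cube_lipschitz_add:
  "cube_lipschitz n f \<Longrightarrow> cube_lipschitz n g \<Longrightarrow> cube_lipschitz n (\<lambda>t. f t + g t)"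
  by (rule cube_lipschitz_if_le[where f = f and g = g and A = 1 and B = 1]) auto

lemma cube_lipschitz_mult:
  assumes "cube_lipschitz n f" "cube_lipschitz n g" shows "cube_lipschitz n (\<lambda>t. f t * g t)"
proof -
  obtain A where A: "0 \<le> A" "\<And>t. t \<in> topspace (unit_cube n) \<Longrightarrow> \<bar>f t\<bar> \<le> A"
    using assms(1) by (rule cube_lipschitz_bounded) (rule that)
  obtain B where B: "0 \<le> B" "\<And>t. t \<in> topspace (unit_cube n) \<Longrightarrow> \<bar>g t\<bar> \<le> B"
    using assms(2) by (rule cube_lipschitz_bounded) (rule that)
  show ?thesis
  proof (rule cube_lipschitz_if_le[OF assms B(1) A(1)])
    fix s t assume st: "s \<in> topspace (unit_cube n)" "t \<in> topspace (unit_cube n)"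
    have "f s * g s - f t * g t = g s * (f s - f t) + f t * (g s - g t)"
      by (simp add: algebra_simps)
    also have "\<bar>\<dots>\<bar> \<le> \<bar>g s\<bar> * \<bar>f s - f t\<bar> + \<bar>f t\<bar> * \<bar>g s - g t\<bar>"
      by (rule order_trans[OF abs_triangle_ineq]) (simp add: abs_mult)
    also have "\<dots> \<le> B * \<bar>f s - f t\<bar> + A * \<bar>g s - g t\<bar>"
      by (intro add_mono mult_right_mono A(2)[OF st(2)] B(2)[OF st(1)]) simp_all
    finally show "\<bar>f s * g s - f t * g t\<bar> \<le> B * \<bar>f s - f t\<bar> + A * \<bar>g s - g t\<bar>" .
  qed
qed

lemma cube_lipschitz_contraction:
  assumes "cube_lipschitz n f" "\<And>u v. \<bar>\<phi> u - \<phi> v\<bar> \<le> \<bar>u - v\<bar>"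
  shows "cube_lipschitz n (\<lambda>t. \<phi> (f t))"
  by (rule cube_lipschitz_if_le[OF assms(1) assms(1), of 1 0]) (simp_all add: assms(2))

lemma cube_lipschitz_inverse:
  assumes "cube_lipschitz n f" "0 < c" "\<And>t. t \<in> topspace (unit_cube n) \<Longrightarrow> c \<le> f t"
  shows "cube_lipschitz n (\<lambda>t. inverse (f t))"
proof (rule cube_lipschitz_if_le[OF assms(1) assms(1), of "inverse c * inverse c" 0])
  fix s t assume st: "s \<in> topspace (unit_cube n)" "t \<in> topspace (unit_cube n)"
  have pos: "0 < f s" "0 < f t" using assms(2,3) st by (meson less_le_trans)+
  have le: "inverse (f s) \<le> inverse c" "inverse (f t) \<le> inverse c"
    using assms(2,3) st by (simp_all add: le_imp_inverse_le)
  have "inverse (f s) - inverse (f t) = - (inverse (f s) * inverse (f t) * (f s - f t))"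
    using pos by (simp add: field_simps)
  then have "\<bar>inverse (f s) - inverse (f t)\<bar> = inverse (f s) * inverse (f t) * \<bar>f s - f t\<bar>"
    using pos by (simp add: abs_mult)
  also have "\<dots> \<le> inverse c * inverse c * \<bar>f s - f t\<bar>"
    using le pos assms(2) by (intro mult_right_mono mult_mono) auto
  finally show "\<bar>inverse (f s) - inverse (f t)\<bar> \<le> inverse c * inverse c * \<bar>f s - f t\<bar> + 0 * \<bar>f s - f t\<bar>"
    by simp
qed (use assms in auto)

lemma cube_lipschitz_continuous:
  assumes "cube_lipschitz n f"
  shows "continuous_on (topspace (unit_cube n)) f"
  unfolding continuous_on_def
proof
  fix s assume s: "s \<in> topspace (unit_cube n)"
  obtain L where L: "0 \<le> L" "\<And>s t. s \<in> topspace (unit_cube n) \<Longrightarrow> t \<in> topspace (unit_cube n) \<Longrightarrow>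
       \<bar>f s - f t\<bar> \<le> L * (\<Sum>l<n. \<bar>s l - t l\<bar>)"
    using assms by (rule cube_lipschitzE) (rule that)
  have proj: "continuous_on (topspace (unit_cube n)) (\<lambda>t. t l)" for l
    by (rule continuous_on_product_then_coordinatewise[OF continuous_on_id])
  have "continuous_on (topspace (unit_cube n)) (\<lambda>t. L * (\<Sum>l<n. \<bar>t l - s l\<bar>))"
    by (intro continuous_intros proj)
  then have "((\<lambda>t. L * (\<Sum>l<n. \<bar>t l - s l\<bar>)) \<longlongrightarrow> L * (\<Sum>l<n. \<bar>s l - s l\<bar>)) (at s within topspace (unit_cube n))"
    using s unfolding continuous_on_def by blast
  then have lim: "((\<lambda>t. L * (\<Sum>l<n. \<bar>t l - s l\<bar>)) \<longlongrightarrow> 0) (at s within topspace (unit_cube n))"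
    by simp
  have "((\<lambda>t. f t - f s) \<longlongrightarrow> 0) (at s within topspace (unit_cube n))"
  proof (rule Lim_null_comparison[OF _ lim])
    show "\<forall>\<^sub>F t in at s within topspace (unit_cube n). norm (f t - f s) \<le> L * (\<Sum>l<n. \<bar>t l - s l\<bar>)"
      unfolding eventually_at_filter by (rule always_eventually) (simp add: L(2) s)
  qed
  then show "(f \<longlongrightarrow> f s) (at s within topspace (unit_cube n))"
    by (rule LIM_zero_cancel)
qed

text \<open>The Lipschitz functions form an algebra that contains the coordinates, so the Stone-Weierstrass
  theorem applies.\<close>

lemma cube_lipschitz_dense:
  assumes f: "continuous_on (topspace (unit_cube n)) f" and e: "0 < e"
  obtains g where "cube_lipschitz n g" "\<And>t. t \<in> topspace (unit_cube n) \<Longrightarrow> \<bar>f t - g t\<bar> < e"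
proof -
  have "\<exists>g. cube_lipschitz n g \<and> (\<forall>t\<in>topspace (unit_cube n). \<bar>f t - g t\<bar> < e)"
  proof (rule Stone_Weierstrass_HOL[where P = "cube_lipschitz n"])
    show "compact (topspace (unit_cube n))"
      using compact_space_unit_cube[of n] unfolding unit_cube_eq_top_of_set compact_space_def
      by (simp add: compactin_subtopology)
    fix s t :: "nat \<Rightarrow> real"
    assume st: "s \<in> topspace (unit_cube n) \<and> t \<in> topspace (unit_cube n) \<and> s \<noteq> t"
    then have "\<exists>i<n. s i \<noteq> t i"
      unfolding topspace_unit_cube by (metis PiE_ext lessThan_iff)
    then show "\<exists>f. cube_lipschitz n f \<and> f s \<noteq> f t"
      using cube_lipschitz_projection by blast
  qed (use f e in \<open>simp_all add: cube_lipschitz_const cube_lipschitz_continuous cube_lipschitz_add cube_lipschitz_mult\<close>)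
  then show ?thesis using that by blast
qed

text \<open>An approximation within \<open>e/2\<close> is moved towards \<open>c\<close> by at most \<open>e/2\<close> (soft thresholding around
  \<open>c\<close>). This does not increase distances and restores the exact value \<open>c\<close> on the boundary.\<close>

lemma cube_lipschitz_dense_rel_boundary:
  assumes f: "continuous_on (topspace (unit_cube n)) f" and e: "0 < e"
    and c: "\<And>t. t \<in> cube_boundary n \<Longrightarrow> f t = c"
  obtains g where "cube_lipschitz n g" "\<And>t. t \<in> topspace (unit_cube n) \<Longrightarrow> \<bar>f t - g t\<bar> < e"
    "\<And>t. t \<in> cube_boundary n \<Longrightarrow> g t = c"
proof -
  \<comment> \<open>\<open>u - c\<close> minus its truncation to \<open>[- e/2, e/2]\<close>, shifted back by \<open>c\<close>.\<close>
  define \<phi> where "\<phi> u = u - max (- (e/2)) (min (e/2) (u - c))" for u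
  have contr: "\<bar>\<phi> u - \<phi> v\<bar> \<le> \<bar>u - v\<bar>" for u v
    by (auto simp: \<phi>_def max_def min_def abs_if)
  have near: "\<bar>u - \<phi> u\<bar> \<le> e/2" for u
    using e by (auto simp: \<phi>_def max_def min_def abs_if)
  have fix_c: "\<phi> u = c" if "\<bar>c - u\<bar> < e/2" for u
    using that by (auto simp: \<phi>_def max_def min_def abs_if split: if_splits)
  obtain g where g: "cube_lipschitz n g" "\<And>t. t \<in> topspace (unit_cube n) \<Longrightarrow> \<bar>f t - g t\<bar> < e/2"
    using cube_lipschitz_dense[OF f half_gt_zero[OF e]] by blast
  show ?thesis
  proof (rule that[of "\<lambda>t. \<phi> (g t)"])
    show "cube_lipschitz n (\<lambda>t. \<phi> (g t))"
      by (rule cube_lipschitz_contraction[OF g(1) contr])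
    show "\<bar>f t - \<phi> (g t)\<bar> < e" if "t \<in> topspace (unit_cube n)" for t
      using g(2)[OF that] near[of "g t"] by linarith
    show "\<phi> (g t) = c" if "t \<in> cube_boundary n" for t
      using g(2)[of t] c[OF that] that cube_boundary_subset by (intro fix_c) auto
  qed
qed

lemma norm_diff_le:
  fixes x y :: "nat \<Rightarrow> real"
  shows "\<bar>sqrt (dotp k x x) - sqrt (dotp k y y)\<bar> \<le> (\<Sum>i\<le>k. \<bar>x i - y i\<bar>)"
proof -
  have eq: "sqrt (dotp k z z) = L2_set z {..k}" for z
    by (simp add: dotp_def L2_set_def power2_eq_square)
  have *: "L2_set x {..k} \<le> L2_set y {..k} + (\<Sum>i\<le>k. \<bar>x i - y i\<bar>)" for x y :: "nat \<Rightarrow> real"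
    using L2_set_triangle_ineq[of y "\<lambda>i. x i - y i" "{..k}"] L2_set_le_sum_abs[of "\<lambda>i. x i - y i" "{..k}"]
    by simp
  show ?thesis
    using *[of x y] *[of y x] by (simp add: eq abs_minus_commute abs_le_iff)
qed

definition normalize_vec :: "nat \<Rightarrow> (nat \<Rightarrow> real) \<Rightarrow> nat \<Rightarrow> real" where
  "normalize_vec k z = (\<lambda>i. z i / sqrt (dotp k z z))"

lemma normalize_vec_unit_sphere:
  assumes "dotp k z z \<noteq> 0" "\<And>i. k < i \<Longrightarrow> z i = 0"
  shows "normalize_vec k z \<in> unit_sphere k"
proof -
  have "dotp k (normalize_vec k z) (normalize_vec k z) = dotp k z z / (sqrt (dotp k z z) * sqrt (dotp k z z))"
    unfolding normalize_vec_def dotp_def sum_divide_distrib by simp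
  then show ?thesis
    using assms dotp_self_nonneg[of k z] by (simp add: unit_sphere_def normalize_vec_def)
qed

lemma normalize_vec_id: "x \<in> unit_sphere k \<Longrightarrow> normalize_vec k x = x"
  by (simp add: normalize_vec_def unit_sphere_def)

lemma continuous_map_normalize_vec:
  assumes "\<And>i. continuous_map X euclideanreal (\<lambda>t. z t i)" "\<And>t. t \<in> topspace X \<Longrightarrow> dotp k (z t) (z t) \<noteq> 0"
  shows "continuous_map X euclideanreal (\<lambda>t. normalize_vec k (z t) i)"
  unfolding normalize_vec_def using assms
  by (intro continuous_map_real_divide continuous_map_sqrt continuous_map_dotp) auto

lemma continuous_map_cube_coordinate:
  assumes "cube_map n (nsphere k) p a"
  shows "continuous_map (unit_cube n) euclideanreal (\<lambda>t. a t i)"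
  using assms by (simp add: cube_map_def continuous_map_into_nsphere)

lemma cube_map_unit_sphere:
  "cube_map n (nsphere k) p a \<Longrightarrow> t \<in> topspace (unit_cube n) \<Longrightarrow> a t \<in> unit_sphere k"
  by (auto simp: cube_map_def continuous_map_into_nsphere)

lemma continuous_map_cylinder_fst:
  "continuous_map (prod_topology (top_of_set {0..1::real}) X) euclideanreal fst"
  by (rule continuous_map_into_fulltopology[OF continuous_map_fst])

lemma continuous_map_cylinder_snd:
  "continuous_map X Y f \<Longrightarrow> continuous_map (prod_topology Z X) Y (\<lambda>x. f (snd x))"
  using continuous_map_compose[OF continuous_map_snd, of X Y f] by (simp add: o_def)

text \<open>Approximate each coordinate closely enough that the segment from \<open>a t\<close> to the approximation
  stays at distance at least 1/2 from the origin, then project the segment radially to the sphere.\<close>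

lemma cube_homotopic_to_lipschitz:
  assumes p: "p \<in> unit_sphere k" and a: "cube_map n (nsphere k) p a"
  obtains r where "cube_homotopic n (nsphere k) p a r" "\<And>j. cube_lipschitz n (\<lambda>t. r t j)"
proof -
  let ?C = "topspace (unit_cube n)" and ?Q = "prod_topology (top_of_set {0..1::real}) (unit_cube n)"
  define e where "e = 1 / (2 * real (Suc k))"
  have e: "0 < e" by (simp add: e_def)
  have "\<exists>g. cube_lipschitz n g \<and> (\<forall>t\<in>?C. \<bar>a t j - g t\<bar> < e) \<and> (\<forall>t\<in>cube_boundary n. g t = p j)" for j
  proof -
    have "continuous_on ?C (\<lambda>t. a t j)"
      using continuous_map_cube_coordinate[OF a, of j]
      by (simp add: unit_cube_eq_top_of_set)
    moreover have "a t j = p j" if "t \<in> cube_boundary n" for t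
      using a that by (simp add: cube_map_def)
    ultimately obtain g where "cube_lipschitz n g" "\<And>t. t \<in> ?C \<Longrightarrow> \<bar>a t j - g t\<bar> < e"
        "\<And>t. t \<in> cube_boundary n \<Longrightarrow> g t = p j"
      using cube_lipschitz_dense_rel_boundary[OF _ e, of n "\<lambda>t. a t j" "p j"] by blast
    then show ?thesis by blast
  qed
  then obtain g where g: "\<And>j. cube_lipschitz n (g j)" "\<And>j t. t \<in> ?C \<Longrightarrow> \<bar>a t j - g j t\<bar> < e"
      "\<And>j t. t \<in> cube_boundary n \<Longrightarrow> g j t = p j"
    by metis
  define G where "G t j = (if j \<le> k then g j t else 0)" for t j
  define Z where "Z = (\<lambda>x j. a (snd x) j + fst x * (G (snd x) j - a (snd x) j))"
  have G_lip: "cube_lipschitz n (\<lambda>t. G t j)" for j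
    by (cases "j \<le> k") (simp_all add: G_def g(1) cube_lipschitz_const)
  have sumG: "(\<Sum>j\<le>k. \<bar>G t j - a t j\<bar>) \<le> 1/2" if "t \<in> ?C" for t
  proof -
    have "(\<Sum>j\<le>k. \<bar>G t j - a t j\<bar>) \<le> (\<Sum>j\<le>k. e)"
      using g(2)[OF that] by (intro sum_mono) (simp add: G_def abs_minus_commute less_imp_le)
    also have "\<dots> = 1/2" by (simp add: e_def field_simps)
    finally show ?thesis .
  qed
  have Z_norm: "1/2 \<le> sqrt (dotp k (Z (s, t)) (Z (s, t)))" if "s \<in> {0..1}" "t \<in> ?C" for s t
  proof -
    have "(\<Sum>i\<le>k. \<bar>Z (s, t) i - a t i\<bar>) \<le> (\<Sum>i\<le>k. \<bar>G t i - a t i\<bar>)"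
      using that(1) by (intro sum_mono) (simp add: Z_def abs_mult mult_left_le_one_le)
    moreover have "sqrt (dotp k (a t) (a t)) = 1"
      using cube_map_unit_sphere[OF a that(2)] by (simp add: unit_sphere_def)
    ultimately show ?thesis
      using sumG[OF that(2)] order_trans[OF abs_ge_minus_self norm_diff_le[of k "Z (s, t)" "a t"]]
      by linarith
  qed
  then have Z_nonzero: "dotp k (Z (s, t)) (Z (s, t)) \<noteq> 0" if "s \<in> {0..1}" "t \<in> ?C" for s t
    using that by fastforce
  have Z_tail: "Z (s, t) i = 0" if "k < i" "t \<in> ?C" for s t i
    using that cube_map_unit_sphere[OF a that(2)] by (simp add: Z_def G_def unit_sphere_def)
  have Z_cont: "continuous_map ?Q euclideanreal (\<lambda>x. Z x j)" for j
  proof -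
    have "continuous_map (unit_cube n) euclideanreal (\<lambda>t. G t j)"
      using cube_lipschitz_continuous[OF G_lip[of j]] by (simp add: unit_cube_eq_top_of_set)
    then show ?thesis
      unfolding Z_def
      by (intro continuous_map_add continuous_map_real_mult continuous_map_diff
          continuous_map_cylinder_fst continuous_map_cylinder_snd continuous_map_cube_coordinate[OF a]
          continuous_map_cylinder_snd[of _ _ "\<lambda>t. G t j"] continuous_map_cylinder_snd[of _ _ "\<lambda>t. a t j"])
  qed
  define r where "r t = normalize_vec k (G t)" for t
  have "cube_homotopic n (nsphere k) p a r"
    unfolding cube_homotopic_iff
  proof (intro exI[of _ "\<lambda>x. normalize_vec k (Z x)"] conjI ballI)
    show "continuous_map ?Q (nsphere k) (\<lambda>x. normalize_vec k (Z x))"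
      unfolding continuous_map_into_nsphere
    proof (intro conjI allI funcsetI)
      show "continuous_map ?Q euclideanreal (\<lambda>x. normalize_vec k (Z x) i)" for i
        by (rule continuous_map_normalize_vec[OF Z_cont]) (use Z_nonzero in auto)
      show "normalize_vec k (Z x) \<in> unit_sphere k" if "x \<in> topspace ?Q" for x
        using that Z_nonzero Z_tail by (cases x) (auto intro!: normalize_vec_unit_sphere)
    qed
    fix t assume t: "t \<in> ?C"
    show "normalize_vec k (Z (0, t)) = a t"
      using normalize_vec_id[OF cube_map_unit_sphere[OF a t]] by (simp add: Z_def)
    show "normalize_vec k (Z (1, t)) = r t"
      by (simp add: Z_def r_def)
  next
    fix s :: real and t assume t: "t \<in> cube_boundary n"
    have "G t j = p j" for j
      using p t g(3) by (simp add: G_def unit_sphere_def)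
    then have "Z (s, t) = p"
      using a t by (simp add: Z_def cube_map_def fun_eq_iff)
    then show "normalize_vec k (Z (s, t)) = p"
      using normalize_vec_id[OF p] by simp
  qed
  moreover have "cube_lipschitz n (\<lambda>t. r t j)" for j
  proof -
    have "cube_lipschitz n (\<lambda>t. sqrt (dotp k (G t) (G t)))"
    proof -
      obtain L where L: "\<And>j s t. s \<in> ?C \<Longrightarrow> t \<in> ?C \<Longrightarrow>
          \<bar>G s j - G t j\<bar> \<le> L j * (\<Sum>l<n. \<bar>s l - t l\<bar>)"
        using G_lip unfolding cube_lipschitz_def by metis
      show ?thesis
        unfolding cube_lipschitz_def
      proof (intro exI[of _ "\<Sum>j\<le>k. L j"] ballI)
        fix s t assume st: "s \<in> ?C" "t \<in> ?C"
        have "\<bar>sqrt (dotp k (G s) (G s)) - sqrt (dotp k (G t) (G t))\<bar> \<le> (\<Sum>j\<le>k. \<bar>G s j - G t j\<bar>)"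
          by (rule norm_diff_le)
        also have "\<dots> \<le> (\<Sum>j\<le>k. L j * (\<Sum>l<n. \<bar>s l - t l\<bar>))"
          by (intro sum_mono L[OF st])
        finally show "\<bar>sqrt (dotp k (G s) (G s)) - sqrt (dotp k (G t) (G t))\<bar>
            \<le> (\<Sum>j\<le>k. L j) * (\<Sum>l<n. \<bar>s l - t l\<bar>)"
          by (simp add: sum_distrib_right)
      qed
    qed
    moreover have "(0::real) < 1/2" by simp
    moreover have "1/2 \<le> sqrt (dotp k (G t) (G t))" if "t \<in> ?C" for t
      using Z_norm[of 1 t] that by (simp add: Z_def)
    ultimately have "cube_lipschitz n (\<lambda>t. inverse (sqrt (dotp k (G t) (G t))))"
      by (rule cube_lipschitz_inverse)
    then show ?thesis
      unfolding r_def normalize_vec_def divide_inverse by (rule cube_lipschitz_mult[OF G_lip])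
  qed
  ultimately show ?thesis by (rule that)
qed

section \<open>Low-dimensional homotopy groups of spheres\<close>

text \<open>Lift the \<open>M\<^sup>k\<close> points of a grid of mesh \<open>1 / (k M)\<close> to the upper hemisphere. If each of them, except
  perhaps \<open>p\<close>, were a value of \<open>r\<close>, then two would be attained in the same cell of a subdivision
  of the cube of mesh \<open>1 / N\<close>, for there are only about \<open>N\<^sup>n\<close> cells. With \<open>N\<close> a fixed large multiple of \<open>M\<close>, the
  Lipschitz bound then contradicts their separation. Excluding \<open>p\<close>, the base point of the
  contraction that follows, costs one grid point.\<close>

lemma lipschitz_sphere_map_misses:
  assumes nk: "n < k" and lip: "\<And>j. cube_lipschitz n (\<lambda>t. r t j)"
  obtains x where "x \<in> unit_sphere k" "x \<noteq> p" "x \<notin> r ` topspace (unit_cube n)"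
proof -
  note witness = that
  let ?C = "topspace (unit_cube n)"
  obtain L where L: "\<And>j s t. s \<in> ?C \<Longrightarrow> t \<in> ?C \<Longrightarrow>
      \<bar>r s j - r t j\<bar> \<le> L j * (\<Sum>l<n. \<bar>s l - t l\<bar>)"
    using lip unfolding cube_lipschitz_def by metis
  define K where "K = (\<Sum>j<k. \<bar>L j\<bar>)"
  have K: "\<bar>r s j - r t j\<bar> \<le> K * (\<Sum>l<n. \<bar>s l - t l\<bar>)" if "j < k" "s \<in> ?C" "t \<in> ?C" for j s t
  proof -
    have "L j \<le> K"
      using member_le_sum[of j "{..<k}" "\<lambda>j. \<bar>L j\<bar>"] that(1) by (simp add: K_def)
    then have "L j * (\<Sum>l<n. \<bar>s l - t l\<bar>) \<le> K * (\<Sum>l<n. \<bar>s l - t l\<bar>)"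
      by (rule mult_right_mono) (simp add: sum_nonneg)
    with L[OF that(2,3), of j] show ?thesis by linarith
  qed
  have K0: "0 \<le> K" by (simp add: K_def sum_nonneg)
  obtain c :: nat where c: "K * n * k < c" using reals_Archimedean2 by blast
  have "0 \<le> K * n * k" using K0 by simp
  with c have c0: "0 < c" by linarith
  \<comment> \<open>As \<open>N + 1 \<le> (c + 1) M\<close>, the first summand makes \<open>M\<^sup>k\<close> exceed the number of cells; the 2 leaves
    room for the excluded point \<open>p\<close>.\<close>
  define M where "M = (c + 1) ^ n + 2"
  define N where "N = c * M"
  have M0: "0 < M" and N0: "0 < N" using c0 by (simp_all add: M_def N_def)
  have count: "(N + 1) ^ n + 1 < M ^ k"
  proof -
    have "N + 1 \<le> (c + 1) * M" using M0 by (simp add: N_def)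
    then have "(N + 1) ^ n \<le> (c + 1) ^ n * M ^ n"
      by (metis power_mono power_mult_distrib le0)
    also have "\<dots> + 2 \<le> (c + 1) ^ n * M ^ n + 2 * M ^ n"
      using M0 by simp
    also have "\<dots> = M ^ Suc n" by (simp add: M_def algebra_simps)
    also have "\<dots> \<le> M ^ k" using nk M0 by (intro power_increasing) auto
    finally show ?thesis by simp
  qed
  define E where "E = PiE {..<k} (\<lambda>_. {..<M})"
  define y where "y m = (\<lambda>i. if i < k then real (m i) / (k * M)
      else if i = k then sqrt (1 - (\<Sum>j<k. (real (m j) / (k * M))\<^sup>2)) else 0)" for m
  have y_sphere: "y m \<in> unit_sphere k" if "m \<in> E" for m
  proof -
    have "(real (m j) / (k * M))\<^sup>2 \<le> 1 / k" if "j < k" for j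
    proof -
      have "m j < M" using \<open>m \<in> E\<close> that by (auto simp: E_def)
      then have q: "real (m j) / (k * M) \<le> 1 / k" "0 \<le> real (m j) / (k * M)"
        using that by (simp_all add: field_simps)
      have "(real (m j) / (k * M))\<^sup>2 \<le> (1 / k)\<^sup>2" using q by (rule power_mono)
      also have "\<dots> \<le> 1 / k" using that by (simp add: power2_eq_square field_simps)
      finally show ?thesis .
    qed
    then have "(\<Sum>j<k. (real (m j) / (k * M))\<^sup>2) \<le> (\<Sum>j<k. 1 / real k)"
      by (intro sum_mono) simp
    also have "\<dots> \<le> 1" by simp
    finally have le1: "(\<Sum>j<k. (real (m j) / (k * M))\<^sup>2) \<le> 1" .
    have "dotp k (y m) (y m) = (\<Sum>i<Suc k. (y m i)\<^sup>2)"
      by (simp add: dotp_def lessThan_Suc_atMost power2_eq_square)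
    also have "\<dots> = (\<Sum>i<k. (y m i)\<^sup>2) + (y m k)\<^sup>2" by simp
    also have "(\<Sum>i<k. (y m i)\<^sup>2) = (\<Sum>j<k. (real (m j) / (k * M))\<^sup>2)"
      by (intro sum.cong refl) (simp add: y_def)
    also have "(y m k)\<^sup>2 = 1 - (\<Sum>j<k. (real (m j) / (k * M))\<^sup>2)"
      using le1 by (simp add: y_def)
    finally show ?thesis by (simp add: unit_sphere_def y_def)
  qed
  have y_inj: "m = m'" if "m \<in> E" "m' \<in> E" "y m = y m'" for m m'
  proof (rule PiE_ext[OF that(1,2)[unfolded E_def]])
    fix j assume "j \<in> {..<k}"
    then have j: "j < k" by simp
    have "y m j = y m' j" by (simp only: that(3))
    then show "m j = m' j"
      using j M0 by (simp add: y_def)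
  qed
  show ?thesis
  proof (rule ccontr)
    assume "\<not> thesis"
    then have hit: "\<exists>t\<in>?C. r t = x" if "x \<in> unit_sphere k" "x \<noteq> p" for x
      using witness[of x] \<open>\<not> thesis\<close> that by blast
    define E' where "E' = {m \<in> E. y m \<noteq> p}"
    have "finite E" by (simp add: E_def finite_PiE)
    have cardE: "card E = M ^ k" by (simp add: E_def card_PiE)
    have "card (E - E') \<le> 1"
    proof -
      have "card (E - E') \<le> Suc 0"
        using \<open>finite E\<close> y_inj by (subst card_le_Suc0_iff_eq) (auto simp: E'_def)
      then show ?thesis by simp
    qed
    moreover have "card E = card E' + card (E - E')"
      using \<open>finite E\<close> by (subst card_Un_disjoint[symmetric]) (auto simp: E'_def intro: arg_cong[where f = card])
    ultimately have big: "(N + 1) ^ n < card E'"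
      using count cardE by simp
    define T where "T m = (SOME t. t \<in> ?C \<and> r t = y m)" for m
    have T: "T m \<in> ?C \<and> r (T m) = y m" if "m \<in> E'" for m
    proof -
      have "\<exists>t. t \<in> ?C \<and> r t = y m"
        using hit[of "y m"] y_sphere[of m] that unfolding E'_def by blast
      then show ?thesis unfolding T_def by (rule someI_ex)
    qed
    define cell where "cell t = restrict (\<lambda>l. nat \<lfloor>N * t l\<rfloor>) {..<n}" for t :: "nat \<Rightarrow> real"
    have "(cell \<circ> T) ` E' \<subseteq> PiE {..<n} (\<lambda>_. {..N})"
    proof clarify
      fix m assume "m \<in> E'"
      then have "T m \<in> ?C" using T by blast
      then have "real N * T m l \<le> real N * 1" if "l < n" for l
        using that unfolding topspace_unit_cube PiE_iff by (intro mult_left_mono) auto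
      then have "nat \<lfloor>N * T m l\<rfloor> \<le> N" if "l < n" for l
        using that by (metis floor_mono floor_of_nat mult.right_neutral nat_int nat_mono)
      then show "(cell \<circ> T) m \<in> PiE {..<n} (\<lambda>_. {..N})"
        by (auto simp: cell_def)
    qed
    then have "card ((cell \<circ> T) ` E') \<le> card (PiE {..<n} (\<lambda>_. {..N}))"
      by (intro card_mono finite_PiE) auto
    also have "\<dots> = (N + 1) ^ n" by (simp add: card_PiE)
    finally have "\<not> inj_on (cell \<circ> T) E'"
      using big by (intro pigeonhole) simp
    then obtain m m' where m: "m \<in> E'" "m' \<in> E'" "cell (T m) = cell (T m')" "m \<noteq> m'"
      by (auto simp: inj_on_def)
    have near: "\<bar>T m l - T m' l\<bar> \<le> 1 / N" if l: "l < n" for l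
    proof -
      have "0 \<le> N * T m l" "0 \<le> N * T m' l"
        using T[OF m(1)] T[OF m(2)] l unfolding topspace_unit_cube PiE_iff by auto
      moreover have "nat \<lfloor>N * T m l\<rfloor> = nat \<lfloor>N * T m' l\<rfloor>"
        using fun_cong[OF m(3), of l] l by (simp add: cell_def)
      ultimately have "\<lfloor>N * T m l\<rfloor> = \<lfloor>N * T m' l\<rfloor>"
        by (simp add: eq_nat_nat_iff)
      then have "\<bar>N * T m l - N * T m' l\<bar> \<le> 1" by linarith
      also have "\<bar>N * T m l - N * T m' l\<bar> = N * \<bar>T m l - T m' l\<bar>"
        by (simp add: abs_mult flip: right_diff_distrib)
      finally show ?thesis using N0 by (simp add: field_simps)
    qed
    obtain j where j: "j < k" "m j \<noteq> m' j"
      using m unfolding E'_def E_def by (metis (no_types, lifting) PiE_ext lessThan_iff mem_Collect_eq)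
    have "1 \<le> \<bar>real (m j) - real (m' j)\<bar>" using j(2) by linarith
    then have "1 / (k * M) \<le> \<bar>real (m j) - real (m' j)\<bar> / (k * M)"
      by (rule divide_right_mono) simp
    also have "\<dots> = \<bar>y m j - y m' j\<bar>"
      using j(1) by (simp add: y_def flip: diff_divide_distrib)
    also have "\<dots> \<le> K * (\<Sum>l<n. \<bar>T m l - T m' l\<bar>)"
      using K[OF j(1), of "T m" "T m'"] T[OF m(1)] T[OF m(2)] by simp
    also have "\<dots> \<le> K * (\<Sum>l<n. 1 / N)"
      using K0 near by (intro mult_left_mono sum_mono) auto
    also have "\<dots> = K * n / (c * M)" by (simp add: N_def)
    finally have "1 / (k * M) * (k * M * c) \<le> K * n / (c * M) * (k * M * c)"
      by (rule mult_right_mono) simp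
    then have "c \<le> K * n * k"
      using j(1) M0 c0 by (simp add: field_simps)
    with c show False by simp
  qed
qed

text \<open>The segment from \<open>r t\<close> to \<open>p\<close> lies in the ball and avoids \<open>x\<close>, an extreme point of the
  ball other than both ends. Sending each of its points \<open>z\<close> to the second intersection of the line
  through \<open>x\<close> and \<open>z\<close> with the sphere, that is to \<open>reflect (z - x) x\<close>, is a homotopy in the sphere.\<close>

lemma cube_homotopic_const_if_misses:
  assumes p: "p \<in> unit_sphere k" and x: "x \<in> unit_sphere k" "x \<noteq> p"
    and r: "cube_map n (nsphere k) p r" and miss: "x \<notin> r ` topspace (unit_cube n)"
  shows "cube_homotopic n (nsphere k) p r (\<lambda>_. p)"
proof -
  let ?C = "topspace (unit_cube n)" and ?Q = "prod_topology (top_of_set {0..1::real}) (unit_cube n)"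
  define W where "W = (\<lambda>y j. r (snd y) j + fst y * (p j - r (snd y) j) - x j)"
  have dot1: "dotp k x x = 1" using x by (simp add: unit_sphere_def)
  have W_nonzero: "dotp k (W (s, t)) (W (s, t)) \<noteq> 0" if s: "s \<in> {0..1}" and t: "t \<in> ?C" for s t
  proof
    assume "dotp k (W (s, t)) (W (s, t)) = 0"
    then have "\<forall>i\<le>k. W (s, t) i = 0"
      by (simp only: dotp_self_eq_0)
    then have "dotp k x (W (s, t)) = 0"
      by (simp add: dotp_def)
    then have eq: "dotp k x (r t) + s * (dotp k x p - dotp k x (r t)) = 1"
      by (simp add: W_def dotp_simps dot1)
    have rt: "dotp k x (r t) < 1"
      using cube_map_unit_sphere[OF r t] miss t by (intro dotp_unit_sphere_less_1 x(1)) auto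
    have "dotp k x p < 1" by (rule dotp_unit_sphere_less_1[OF x(1) p x(2)])
    have "(1 - s) * (1 - dotp k x (r t)) + s * (1 - dotp k x p) = 0"
      using eq by (simp add: algebra_simps)
    moreover have "0 \<le> (1 - s) * (1 - dotp k x (r t))" "0 \<le> s * (1 - dotp k x p)"
      using s rt \<open>dotp k x p < 1\<close> by auto
    ultimately have "(1 - s) * (1 - dotp k x (r t)) = 0" "s * (1 - dotp k x p) = 0"
      by linarith+
    with rt \<open>dotp k x p < 1\<close> show False by auto
  qed
  have W_tail: "W (s, t) i = 0" if "k < i" "t \<in> ?C" for s t i
    using that p x cube_map_unit_sphere[OF r that(2)] by (simp add: W_def unit_sphere_def)
  have W_cont: "continuous_map ?Q euclideanreal (\<lambda>y. W y j)" for j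
    unfolding W_def
    by (intro continuous_map_add continuous_map_real_mult continuous_map_diff
        continuous_map_cylinder_fst continuous_map_cylinder_snd[of _ _ "\<lambda>t. r t j"]
        continuous_map_cube_coordinate[OF r]) simp_all
  show ?thesis
    unfolding cube_homotopic_iff
  proof (intro exI[of _ "\<lambda>y. reflect k (W y) x"] conjI ballI)
    show "continuous_map ?Q (nsphere k) (\<lambda>y. reflect k (W y) x)"
      unfolding continuous_map_into_nsphere
    proof (intro conjI allI funcsetI)
      show "continuous_map ?Q euclideanreal (\<lambda>y. reflect k (W y) x i)" for i
        by (rule continuous_map_reflect[OF W_cont]) (use W_nonzero in auto)
      show "reflect k (W y) x \<in> unit_sphere k" if "y \<in> topspace ?Q" for y
        using that W_tail by (cases y) (auto intro!: reflect_unit_sphere x(1))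
    qed
    fix t assume t: "t \<in> ?C"
    show "reflect k (W (0, t)) x = r t"
      using reflect_swap[OF x(1) cube_map_unit_sphere[OF r t]] by (simp add: W_def)
    show "reflect k (W (1, t)) x = p"
      using reflect_swap[OF x(1) p] by (simp add: W_def)
  next
    fix s :: real and t assume t: "t \<in> cube_boundary n"
    then show "reflect k (W (s, t)) x = p"
      using reflect_swap[OF x(1) p] r by (simp add: W_def cube_map_def)
  qed
qed

lemma cube_homotopic_const_low_dimension:
  assumes "n < k" and p: "p \<in> unit_sphere k" and a: "cube_map n (nsphere k) p a"
  shows "cube_homotopic n (nsphere k) p a (\<lambda>_. p)"
proof -
  obtain r where r: "cube_homotopic n (nsphere k) p a r" "\<And>j. cube_lipschitz n (\<lambda>t. r t j)"
    by (rule cube_homotopic_to_lipschitz[OF p a]) (rule that)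
  obtain x where x: "x \<in> unit_sphere k" "x \<noteq> p" "x \<notin> r ` topspace (unit_cube n)"
    by (rule lipschitz_sphere_map_misses[OF \<open>n < k\<close> r(2)]) (rule that)
  have "cube_homotopic n (nsphere k) p r (\<lambda>_. p)"
    by (rule cube_homotopic_const_if_misses[OF p x(1,2) cube_homotopic_imp_cube_map(2)[OF r(1)] x(3)])
  with r(1) show ?thesis by (rule cube_homotopic_trans)
qed

lemma based_self_map_const: "p \<in> topspace X \<Longrightarrow> based_self_map X p (\<lambda>_. p)"
  by (simp add: based_self_map_def)

lemma const_induces_homotopy_iso_low_dimension:
  assumes "n < k" and p: "p \<in> unit_sphere k"
  shows "induces_homotopy_iso n (nsphere k) p (\<lambda>_. p)"
proof -
  have c: "based_self_map (nsphere k) p (\<lambda>_. p)"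
    using p by (simp add: based_self_map_const topspace_nsphere_eq)
  have m: "cube_map n (nsphere k) p (\<lambda>_. p)"
    using p by (simp add: cube_map_def topspace_nsphere_eq)
  have trivial: "cube_class n (nsphere k) p a = cube_class n (nsphere k) p (\<lambda>_. p)"
    if "cube_map n (nsphere k) p a" for a
    using cube_homotopic_const_low_dimension[OF assms that] that by (simp add: cube_class_eq_iff)
  have "carrier (homotopy_group n (nsphere k) p) =
      cube_class n (nsphere k) p ` Collect (cube_map n (nsphere k) p)"
    by (simp add: homotopy_group_def setcompr_eq_image)
  also have "\<dots> = (\<lambda>_. cube_class n (nsphere k) p (\<lambda>_. p)) ` Collect (cube_map n (nsphere k) p)"
    by (rule image_cong) (simp_all add: trivial)
  also have "\<dots> = {cube_class n (nsphere k) p (\<lambda>_. p)}"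
    using m by (subst image_constant_conv) auto
  finally have "carrier (homotopy_group n (nsphere k) p) = {cube_class n (nsphere k) p (\<lambda>_. p)}" .
  moreover have "homotopy_group_map n (nsphere k) p (\<lambda>_. p) (cube_class n (nsphere k) p (\<lambda>_. p)) =
      cube_class n (nsphere k) p (\<lambda>_. p)"
    using homotopy_group_map_class[OF c m] by (simp add: o_def)
  ultimately show ?thesis
    by (simp add: induces_homotopy_iso_iff[OF c] bij_betw_def)
qed

lemma left_inverse_if_based_homotopic:
  assumes fg: "based_homotopic X p f g" and f: "based_self_equivalence X p f"
  shows "\<exists>h. based_self_map X p h \<and> based_homotopic X p (h \<circ> g) id"
proof -
  obtain h where h: "based_self_map X p h" "based_homotopic X p (h \<circ> f) id"
    using f by (auto simp: based_self_equivalence_def)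
  have "based_homotopic X p (h \<circ> f) (h \<circ> g)"
    using fg unfolding based_homotopic_def
    by (rule homotopic_with_compose_continuous_map_left)
      (use h(1) in \<open>simp_all add: based_self_map_def\<close>)
  then have "based_homotopic X p (h \<circ> g) id"
    using h(2) unfolding based_homotopic_def by (meson homotopic_with_symD homotopic_with_trans)
  with h(1) show ?thesis by blast
qed

text \<open>If the constant map were homotopic to an equivalence with inverse \<open>h\<close>, then \<open>h \<circ> const = const\<close>
  would be homotopic to the identity.\<close>

lemma const_class_not_equivalence:
  assumes p: "p \<in> topspace (nsphere k)"
  shows "self_map_class (nsphere k) p (\<lambda>_. p) \<notin> self_equivalence_classes (nsphere k) p"
proof
  let ?X = "nsphere k"
  assume "self_map_class ?X p (\<lambda>_. p) \<in> self_equivalence_classes ?X p"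
  then obtain f where f: "based_self_equivalence ?X p f"
      and eq: "self_map_class ?X p (\<lambda>_. p) = self_map_class ?X p f"
    unfolding self_equivalence_classes_def by blast
  have "(\<lambda>_. p) \<in> self_map_class ?X p (\<lambda>_. p)"
    using p by (simp add: self_map_class_def based_homotopic_def)
  then have "based_homotopic ?X p f (\<lambda>_. p)"
    unfolding eq by (simp add: self_map_class_def)
  then obtain h where h: "based_self_map ?X p h" "based_homotopic ?X p (h \<circ> (\<lambda>_. p)) id"
    using left_inverse_if_based_homotopic[OF _ f] by blast
  have "homotopic_with (\<lambda>_. True) ?X ?X id (\<lambda>_. p)"
  proof (rule homotopic_with_symD, rule homotopic_with_mono)
    show "homotopic_with (\<lambda>g. g p = p) ?X ?X (\<lambda>_. p) id"
      using h by (simp add: based_homotopic_def based_self_map_def o_def)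
  qed simp
  then show False
    using non_contractible_space_nsphere[of k] unfolding contractible_space_def by blast
qed

theorem corollary2:
  fixes k :: nat and p :: "nat \<Rightarrow> real"
  assumes "k \<ge> 1" and "p \<in> topspace (nsphere k)"
  shows "self_closeness_number (nsphere k) p = enat k"
proof -
  let ?X = "nsphere k"
  let ?J = "{j. sharp_classes j ?X p = self_equivalence_classes ?X p}"
  have p: "p \<in> unit_sphere k" using assms(2) by (simp add: topspace_nsphere_eq)
  obtain q where q: "collapse_map k ?X p q"
    using nsphere_collapse_map[of k p] assms(1) p by auto
  have equiv: "based_self_equivalence ?X p f \<longleftrightarrow>
      based_self_map ?X p f \<and> (\<forall>i\<le>k. induces_homotopy_iso i ?X p f)" for f
  proof
    assume f: "based_self_equivalence ?X p f"
    then show "based_self_map ?X p f \<and> (\<forall>i\<le>k. induces_homotopy_iso i ?X p f)"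
      using based_self_equivalence_induces_homotopy_iso[OF f] by (simp add: based_self_equivalence_def)
  next
    assume "based_self_map ?X p f \<and> (\<forall>i\<le>k. induces_homotopy_iso i ?X p f)"
    then show "based_self_equivalence ?X p f"
      using homotopy_iso_imp_based_self_equivalence[OF Hausdorff_space_nsphere q assms(2)] by simp
  qed
  have "k \<in> ?J"
    by (simp add: sharp_classes_def self_equivalence_classes_def equiv)
  moreover have "k \<le> j" if "j \<in> ?J" for j
  proof (rule ccontr)
    assume "\<not> k \<le> j"
    then have "self_map_class ?X p (\<lambda>_. p) \<in> sharp_classes j ?X p"
      unfolding sharp_classes_def
      using const_induces_homotopy_iso_low_dimension[OF _ p] based_self_map_const[OF assms(2)]
      by (intro CollectI exI[of _ "\<lambda>_. p"] conjI allI impI refl) (use \<open>\<not> k \<le> j\<close> in simp_all)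
    with that const_class_not_equivalence[OF assms(2)] show False by simp
  qed
  ultimately show ?thesis
    unfolding self_closeness_number_def by (intro cInf_eq_minimum) auto
qed

end
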